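(* Let $r\ge1$ be an integer and consider the cellular automata $F_{(1,2)},F_{(3,4)},F_{(1,3)},F_{(1)}$ of radius $r$ on $\{0,1\}^{\mathbb{Z}^2}$ defined by the local rules $$f_{(1,2)}=x_{(r,0)}+x_{(0,r)}\bmod 2,\quad f_{(3,4)}=x_{(-r,0)}+x_{(0,-r)}\bmod 2,\quad f_{(1,3)}=x_{(r,0)}+x_{(-r,0)}\bmod 2,\quad f_{(1)}=x_{(r,0)}.$$ With $\mu_\lambda$ the uniform measure on $\{0,1\}^{\mathbb{Z}^2}$, $$ER_{\mu_\lambda}(\{0,1\}^{\mathbb{Z}^2},F_{(1,2)})=ER_{\mu_\lambda}(\{0,1\}^{\mathbb{Z}^2},F_{(3,4)})=ER_{\mu_\lambda}(\{0,1\}^{\mathbb{Z}^2},F_{(1,3)})=4r\ln 2$$ and $$ER_{\mu_\lambda}(\{0,1\}^{\mathbb{Z}^2},F_{(1)})=2r\ln 2.$$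
   Context: Let $A=\{0,1\}$. $A^{\mathbb{Z}^2}$ carries the product of discrete topologies and its Borel $\sigma$-algebra; $\mu_\lambda$ is the product measure giving each letter weight $1/2$ at each site. The shifts are $\sigma^v(x)_u=x_{u+v}$, $u,v\in\mathbb{Z}^2$. Let $E_n=\{(i,j)\in\mathbb{Z}^2: -n\le i,j\le n\}$. The cellular automaton of radius $r$ with local rule $f:A^{E_r}\to A$ is $F(x)_z=f\big((x_{z+u})_{u\in E_r}\big)$, $z\in\mathbb{Z}^2$. For $n\ge r$, $E'_n=E_n\setminus E_{n-r}$. For a finite measurable partition $\mathcal{P}$, $\mathcal{P}'_n=\bigvee_{v\in E'_n}\sigma^v(\mathcal{P})$. $h_\mu(\mathcal{P},F)=\lim_{N}\frac1N H_\mu(\bigvee_{i=0}^{N-1}F^{-i}\mathcal{P})$ with $H_\mu$ the Shannon entropy of a partition (natural logarithm). For an $F$-invariant probability measure $\mu$, $ER_\mu(\mathcal{P},F)=\limsup_{n\to\infty}\frac1n h_\mu(\mathcal{P}'_n,F)$, and $ER_\mu(A^{\mathbb{Z}^2},F)=\sup_{\mathcal{P}}ER_\mu(\mathcal{P},F)$ over all finite measurable partitions. *)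

theory Defs
  imports "HOL-Probability.Probability" "HOL-Library.Z2"
begin

type_synonym site = "int \<times> int"
type_synonym 'a config = "site \<Rightarrow> 'a"

definition shift :: "site \<Rightarrow> 'a config \<Rightarrow> 'a config" where
  "shift v x = (\<lambda>u. x (u + v))"

definition square :: "nat \<Rightarrow> site set" where
  "square n = {- int n..int n} \<times> {- int n..int n}"

(* Only relevant for n \<ge> r; for n < r the natural-number difference is 0. *)
definition frame :: "nat \<Rightarrow> nat \<Rightarrow> site set" where
  "frame r n = square n - square (n - r)"

(* A local rule on A^(E_r) is a function on configurations, of which only the values
   on arguments restricted to the square of radius r are used. *)
definition cellular_automaton ::
    "nat \<Rightarrow> ('a config \<Rightarrow> 'a) \<Rightarrow> 'a config \<Rightarrow> 'a config" where
  "cellular_automaton r f x = (\<lambda>z. f (restrict (\<lambda>u. x (z + u)) (square r)))"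

definition finite_measurable_partition :: "'x measure \<Rightarrow> 'x set set \<Rightarrow> bool" where
  "finite_measurable_partition M P \<longleftrightarrow> finite P \<and> partition_on (space M) P \<and> P \<subseteq> sets M"

definition join_partitions :: "'i set \<Rightarrow> ('i \<Rightarrow> 'x set set) \<Rightarrow> 'x set set" where
  "join_partitions I Q = {(\<Inter>i\<in>I. c i) | c. \<forall>i\<in>I. c i \<in> Q i} - {{}}"

(* Cells of measure 0 contribute 0, since 0 * ln 0 = 0. *)
definition partition_entropy :: "'x measure \<Rightarrow> 'x set set \<Rightarrow> real" where
  "partition_entropy M P = - (\<Sum>p\<in>P. measure M p * ln (measure M p))"

(* The underlying space of M is meant to be all of 'x, so preimages are not intersected with it. *)
definition dynamical_entropy :: "'x measure \<Rightarrow> 'x set set \<Rightarrow> ('x \<Rightarrow> 'x) \<Rightarrow> real" where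
  "dynamical_entropy M P F =
     lim (\<lambda>N. partition_entropy M
                (join_partitions {..<N} (\<lambda>i. (\<lambda>p. (F ^^ i) -` p) ` P)) / real N)"

definition frame_partition :: "nat \<Rightarrow> nat \<Rightarrow> 'a config set set \<Rightarrow> 'a config set set" where
  "frame_partition r n P = join_partitions (frame r n) (\<lambda>v. (\<lambda>p. shift v ` p) ` P)"

(* The limsup and the supremum are taken in the extended reals, so that they always exist. *)
definition entropy_rate_partition ::
    "nat \<Rightarrow> 'a config measure \<Rightarrow> 'a config set set \<Rightarrow> ('a config \<Rightarrow> 'a config) \<Rightarrow> ereal" where
  "entropy_rate_partition r M P F =
     limsup (\<lambda>n. ereal (dynamical_entropy M (frame_partition r n P) F / real n))"

definition entropy_rate ::
    "nat \<Rightarrow> 'a config measure \<Rightarrow> ('a config \<Rightarrow> 'a config) \<Rightarrow> ereal" where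
  "entropy_rate r M F =
     (SUP P\<in>{P. finite_measurable_partition M P}. entropy_rate_partition r M P F)"

(* The alphabet {0,1} is the type bit, whose addition is addition modulo 2. *)
definition uniform_bernoulli :: "bit config measure" where
  "uniform_bernoulli = PiM UNIV (\<lambda>_. uniform_count_measure UNIV)"

definition rule_12 :: "nat \<Rightarrow> bit config \<Rightarrow> bit" where
  "rule_12 r x = x (int r, 0) + x (0, int r)"

definition rule_34 :: "nat \<Rightarrow> bit config \<Rightarrow> bit" where
  "rule_34 r x = x (- int r, 0) + x (0, - int r)"

definition rule_13 :: "nat \<Rightarrow> bit config \<Rightarrow> bit" where
  "rule_13 r x = x (int r, 0) + x (- int r, 0)"

definition rule_1 :: "nat \<Rightarrow> bit config \<Rightarrow> bit" where
  "rule_1 r x = x (int r, 0)"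

lemma UNIV_bit: "(UNIV :: bit set) = {0, 1}"
  by (auto intro: bit.exhaust)

lemma finite_UNIV_bit [simp]: "finite (UNIV :: bit set)"
  by (simp add: UNIV_bit)

lemma measure_letter: "measure (uniform_count_measure UNIV) {a :: bit} = 1 / 2"
  by (simp add: measure_uniform_count_measure) (simp add: UNIV_bit)

lemma prob_space_uniform_bernoulli: "prob_space uniform_bernoulli"
  unfolding uniform_bernoulli_def
  by (intro prob_space_PiM prob_space_uniform_count_measure) auto

lemma space_uniform_bernoulli [simp]: "space uniform_bernoulli = UNIV"
  by (simp add: uniform_bernoulli_def space_PiM space_uniform_count_measure)

text \<open>The product sigma-algebra is the Borel sigma-algebra of the product of the
  discrete topologies.\<close>

lemma sets_uniform_bernoulli_borel:
  "sets uniform_bernoulli =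
     sigma_sets UNIV {U. openin (product_topology (\<lambda>_. discrete_topology UNIV) UNIV) U}"
    (is "_ = sigma_sets UNIV ?O")
proof
  have gen: "sets uniform_bernoulli = sigma_sets UNIV {{x. x i \<in> A} | i (A :: bit set). True}"
    unfolding uniform_bernoulli_def
    by (subst sets_PiM_single)
      (simp add: space_uniform_count_measure sets_uniform_count_measure)
  have "{x. x i \<in> A} \<in> ?O" for i :: site and A :: "bit set"
    using openin_continuous_map_preimage
      [OF continuous_map_product_projection[of i UNIV "\<lambda>_. discrete_topology UNIV"], of A]
    by simp
  then show "sets uniform_bernoulli \<subseteq> sigma_sets UNIV ?O"
    unfolding gen by (intro sigma_sets_mono') auto
  define cyl :: "site set \<times> site set \<Rightarrow> bit config set"
    where "cyl = (\<lambda>(J, S). {x. \<forall>i\<in>J. x i = 1 \<longleftrightarrow> i \<in> S})"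
  have cyl: "cyl JS \<in> sets uniform_bernoulli" if "finite (fst JS)" for JS
  proof -
    obtain J S where JS: "JS = (J, S)" by fastforce
    have "{x. x i = 1 \<longleftrightarrow> i \<in> S} \<in> sets uniform_bernoulli" for i
    proof -
      have "{x. x i = 1 \<longleftrightarrow> i \<in> S} = {x. x i \<in> {a. a = 1 \<longleftrightarrow> i \<in> S}}" by simp
      then show ?thesis unfolding gen by (intro sigma_sets.Basic) blast
    qed
    then have "{x \<in> space uniform_bernoulli. \<forall>i\<in>J. x i = 1 \<longleftrightarrow> i \<in> S} \<in> sets uniform_bernoulli"
      using that by (intro sets.sets_Collect_finite_All) (auto simp: JS)
    then show ?thesis by (simp add: cyl_def JS)
  qed
  have "U \<in> sets uniform_bernoulli" if U: "U \<in> ?O" for U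
  proof -
    let ?C = "{JS \<in> {J. finite J} \<times> {S. finite S}. cyl JS \<subseteq> U}"
    have "\<exists>JS\<in>?C. x \<in> cyl JS" if "x \<in> U" for x
    proof -
      obtain V where V: "finite {i. V i \<noteq> (UNIV :: bit set)}" "x \<in> Pi\<^sub>E UNIV V" "Pi\<^sub>E UNIV V \<subseteq> U"
        using U \<open>x \<in> U\<close> by (auto simp: openin_product_topology_alt)
      let ?J = "{i. V i \<noteq> UNIV}"
      let ?JS = "(?J, {i \<in> ?J. x i = 1})"
      have "y \<in> U" if "y \<in> cyl ?JS" for y
      proof -
        have iff: "y i = 1 \<longleftrightarrow> x i = 1" if "i \<in> ?J" for i
          using \<open>y \<in> cyl ?JS\<close> that unfolding cyl_def by blast
        have "y i = x i" if "i \<in> ?J" for i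
          using iff[OF that] by (cases "x i"; cases "y i") simp_all
        moreover have "x i \<in> V i" for i
          using V(2) by (rule PiE_mem) simp
        ultimately have "y i \<in> V i" for i
          by (metis UNIV_I mem_Collect_eq)
        then show ?thesis using V(3) by (auto simp: PiE_iff)
      qed
      then have "?JS \<in> ?C" using V(1) by auto
      moreover have "x \<in> cyl ?JS" by (auto simp: cyl_def)
      ultimately show ?thesis by blast
    qed
    then have "U = (\<Union>JS\<in>?C. cyl JS)" by blast
    moreover have "countable ({J :: site set. finite J} \<times> {S :: site set. finite S})"
      using countable_Collect_finite[where 'a = site] by auto
    then have "countable ?C"
      by (rule countable_subset[rotated]) auto
    then have "(\<Union>JS\<in>?C. cyl JS) \<in> sets uniform_bernoulli"
      by (rule sets.countable_UN') (auto intro!: cyl)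
    ultimately show ?thesis by simp
  qed
  then show "sigma_sets UNIV ?O \<subseteq> sets uniform_bernoulli"
    using sets.sigma_sets_subset[of ?O uniform_bernoulli] by auto
qed

end

theory Submission
  imports Defs
begin

text \<open>Each of the four automata is a neighbour sum \<open>F x z = (\<Sum>u\<in>U. x (z + u))\<close>. Call a site of the
  square \<open>E\<^sub>n\<close> exterior if its neighbourhood \<open>z + U\<close> leaves a suitable region \<open>E n\<close> (a quadrant, strip or
  half-plane) that contains the square; all exterior sites lie in the frame.

  Lower bound: the equation \<open>F x = y\<close> can be solved outside the region by recursion, so the values
  \<open>F\<^sup>i x z\<close> at exterior sites \<open>z\<close> and times \<open>i < N\<close> can be prescribed arbitrarily. Being additive functions
  of \<open>x\<close>, they are independent and uniform under the Bernoulli measure, and contribute \<open>ln 2\<close> each.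

  Upper bound: the values \<open>F\<^sup>i x\<close> on the square for \<open>i < N\<close> are determined by those of \<open>x\<close> on the square and
  of \<open>F\<^sup>i x\<close> at the exterior sites. An arbitrary finite partition agrees with one into local events up
  to events of small entropy, which are absorbed by subadditivity since the frame has linear size.

  The number of exterior sites is \<open>4 r n + O(1)\<close> for the three sums and \<open>2 r n + O(1)\<close> for the shift \<open>rule_1\<close>.\<close>

section \<open>Entropy of level-set partitions\<close>

text \<open>Subadditivity along \<open>n = q * m + s\<close> bounds \<open>a n / n\<close> by
  \<open>a m / m\<close> up to a vanishing error, so the quotients tend to their infimum. This is
  what gives the \<open>lim\<close> in \<open>dynamical_entropy\<close> a meaning.\<close>

lemma fekete_convergent:
  fixes a :: "nat \<Rightarrow> real"
  assumes sub: "\<And>m n. a (m + n) \<le> a m + a n" and nonneg: "\<And>n. 0 \<le> a n"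
  shows "convergent (\<lambda>n. a n / real n)"
proof -
  define L where "L = Inf ((\<lambda>n. a n / real n) ` {1..})"
  have bdd: "bdd_below ((\<lambda>n. a n / real n) ` {1..})"
    by (rule bdd_belowI[of _ 0]) (auto simp: nonneg)
  have mult: "a (q * m + s) \<le> real q * a m + a s" for q m s
  proof (induction q)
    case (Suc q)
    have "a (Suc q * m + s) \<le> a m + a (q * m + s)"
      using sub[of m "q * m + s"] by (simp add: algebra_simps)
    with Suc show ?case by (simp add: algebra_simps)
  qed simp
  have "(\<lambda>n. a n / real n) \<longlonglongrightarrow> L"
  proof (rule order_tendstoI)
    fix l assume "l < L"
    have "l < a n / real n" if "n \<ge> 1" for n
      using cInf_lower[OF _ bdd, of "a n / real n"] that \<open>l < L\<close> unfolding L_def by force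
    then show "\<forall>\<^sub>F n in sequentially. l < a n / real n"
      by (auto simp: eventually_sequentially)
  next
    fix u assume "L < u"
    then obtain m where m: "m \<ge> 1" "a m / real m < u"
      unfolding L_def by (subst (asm) cInf_less_iff[OF _ bdd]) auto
    \<comment> \<open>As all terms are nonnegative, the sum bounds every possible remainder term
      \<open>a s\<close> at once.\<close>
    define C where "C = (\<Sum>s<m. a s)"
    have C: "a s \<le> C" if "s < m" for s
      unfolding C_def using that by (intro member_le_sum) (auto simp: nonneg)
    have le: "a n / real n \<le> a m / real m + C / real n" if "n \<ge> 1" for n
    proof -
      have "a n \<le> real (n div m) * a m + a (n mod m)"
        using mult[of "n div m" m "n mod m"] by simp
      also have "a (n mod m) \<le> C" using m by (intro C) simp
      also have "real (n div m) * a m \<le> (real n / real m) * a m"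
        using nonneg of_nat_div_le_of_nat[of n m] by (intro mult_right_mono) auto
      finally have "a n \<le> (real n / real m) * a m + C" by simp
      then show ?thesis using that m by (simp add: field_simps)
    qed
    have "(\<lambda>n. a m / real m + C / real n) \<longlonglongrightarrow> a m / real m + 0"
      by (intro tendsto_intros lim_const_over_n)
    then have "\<forall>\<^sub>F n in sequentially. a m / real m + C / real n < u"
      using m by (intro order_tendstoD) auto
    then show "\<forall>\<^sub>F n in sequentially. a n / real n < u"
      using eventually_ge_at_top[of 1] by eventually_elim (use le in force)
  qed
  then show ?thesis by (rule convergentI)
qed

text \<open>Partitions are handled as level sets of functions, so that joins become tuples and the
  entropy theory of random variables applies.\<close>

definition level_sets :: "('x \<Rightarrow> 'b) \<Rightarrow> 'x set set" where
  "level_sets X = range (\<lambda>x. X -` {X x})"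

lemma vimage_tuple:
  "(\<lambda>x. \<lambda>i\<in>I. X i (T i x)) -` {\<lambda>i\<in>I. X i (T i x)} = (\<Inter>i\<in>I. T i -` X i -` {X i (T i x)})"
proof -
  have "(\<lambda>i\<in>I. X i (T i y)) = (\<lambda>i\<in>I. X i (T i x)) \<longleftrightarrow> (\<forall>i\<in>I. X i (T i y) = X i (T i x))" for y
    unfolding fun_eq_iff restrict_def by presburger
  then show ?thesis by auto
qed

text \<open>One statement serves two kinds of join: over time with \<open>T i\<close> an iterate of
  the automaton, and over the frame with \<open>T i\<close> a shift.\<close>

lemma join_level_sets:
  "join_partitions I (\<lambda>i. (\<lambda>p. T i -` p) ` level_sets (X i)) =
     level_sets (\<lambda>x. \<lambda>i\<in>I. X i (T i x))"
proof (intro set_eqI iffI)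
  fix p assume "p \<in> join_partitions I (\<lambda>i. (\<lambda>p. T i -` p) ` level_sets (X i))"
  then obtain c where p: "p = (\<Inter>i\<in>I. c i)" "p \<noteq> {}"
    and mem: "\<forall>i\<in>I. c i \<in> (\<lambda>p. T i -` p) ` level_sets (X i)"
    unfolding join_partitions_def by blast
  have c: "\<exists>z. c i = T i -` X i -` {X i z}" if "i \<in> I" for i
    using bspec[OF mem that] unfolding level_sets_def by blast
  \<comment> \<open>A point of the nonempty intersection can replace the separately chosen
    representatives of all the \<open>c i\<close>.\<close>
  obtain x where x: "x \<in> p" using p by auto
  have "c i = T i -` X i -` {X i (T i x)}" if "i \<in> I" for i
    using c[OF that] x that p(1) by auto
  then have "p = (\<Inter>i\<in>I. T i -` X i -` {X i (T i x)})" using p(1) by auto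
  then have "p = (\<lambda>x. \<lambda>i\<in>I. X i (T i x)) -` {\<lambda>i\<in>I. X i (T i x)}"
    by (simp add: vimage_tuple)
  then show "p \<in> level_sets (\<lambda>x. \<lambda>i\<in>I. X i (T i x))" by (auto simp: level_sets_def)
next
  fix p assume "p \<in> level_sets (\<lambda>x. \<lambda>i\<in>I. X i (T i x))"
  then obtain x where p: "p = (\<lambda>x. \<lambda>i\<in>I. X i (T i x)) -` {\<lambda>i\<in>I. X i (T i x)}"
    by (auto simp: level_sets_def)
  then have "p = (\<Inter>i\<in>I. T i -` X i -` {X i (T i x)})"
    by (simp add: vimage_tuple)
  moreover have "x \<in> p" by (simp add: p)
  ultimately show "p \<in> join_partitions I (\<lambda>i. (\<lambda>p. T i -` p) ` level_sets (X i))"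
    unfolding join_partitions_def level_sets_def
    by (auto intro!: exI[of _ "\<lambda>i. T i -` X i -` {X i (T i x)}"])
qed

text \<open>\<open>X\<close> sends each point to the cell that contains it.\<close>

lemma partition_level_sets:
  assumes "partition_on UNIV P"
  obtains X where "level_sets X = P" "\<And>x. X x \<in> P" "\<And>p x. p \<in> P \<Longrightarrow> x \<in> p \<longleftrightarrow> X x = p"
proof -
  have "\<exists>p\<in>P. x \<in> p" for x
    using assms by (auto simp: partition_on_def)
  then obtain X where X: "\<And>x. X x \<in> P \<and> x \<in> X x" by metis
  have eq: "x \<in> p \<longleftrightarrow> X x = p" if "p \<in> P" for p x
    using assms X[of x] that unfolding partition_on_def disjoint_def by blast
  have *: "X -` {p} = p" if "p \<in> P" for p
    using eq[OF that] by auto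
  have "level_sets X = P"
  proof -
    have "p \<in> range X" if "p \<in> P" for p
    proof -
      have "p \<noteq> {}" using assms that by (auto simp: partition_on_def)
      then show ?thesis using eq[OF that] by blast
    qed
    then have "range X = P" using X by auto
    then have "P = range (\<lambda>x. X x)" by simp
    also have "\<dots> = level_sets X" unfolding level_sets_def using * X by simp
    finally show ?thesis by simp
  qed
  with X eq show ?thesis using that by blast
qed

text \<open>Preimages in \<open>dynamical_entropy\<close> are not intersected with the space, so the
  space has to be the whole type.\<close>

locale full_prob_space = prob_space M for M :: "'x measure" +
  assumes space_UNIV [simp]: "space M = UNIV"

text \<open>The base \<open>exp 1\<close> makes the logarithm of the information-theoretic entropy
  the natural one.\<close>

sublocale full_prob_space \<subseteq> information_space M "exp 1"
  by standard simp

section \<open>Entropy inequalities for finite-valued functions\<close>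

context full_prob_space
begin

abbreviation level_entropy :: "('x \<Rightarrow> 'b) \<Rightarrow> real" where
  "level_entropy X \<equiv> partition_entropy M (level_sets X)"

lemma simple_function_iff:
  "simple_function M X \<longleftrightarrow> finite (range X) \<and> (\<forall>b. X -` {b} \<in> sets M)"
proof -
  have "X -` {b} = {}" if "b \<notin> range X" for b using that by auto
  then show ?thesis unfolding simple_function_def by simp (metis sets.empty_sets rangeI image_iff)
qed

lemma level_entropy_sum:
  "level_entropy X = - (\<Sum>b\<in>range X. prob (X -` {b}) * ln (prob (X -` {b})))"
proof -
  have "level_sets X = (\<lambda>b. X -` {b}) ` range X" by (auto simp: level_sets_def)
  moreover have "inj_on (\<lambda>b. X -` {b}) (range X)" by (auto simp: inj_on_def)
  ultimately show ?thesis by (simp add: partition_entropy_def sum.reindex)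
qed

lemma level_entropy_eq:
  assumes "simple_function M X"
  shows "level_entropy X = entropy (exp 1) (count_space (range X)) X"
proof -
  have "log (exp 1) = ln" by (simp add: log_def fun_eq_iff)
  then show ?thesis
    using entropy_simple_distributed[OF simple_distributedI[OF assms measure_nonneg refl]]
    by (simp add: level_entropy_sum)
qed

lemma simple_function_tuple:
  assumes "finite I" and "\<And>i. i \<in> I \<Longrightarrow> simple_function M (X i)"
  shows "simple_function M (\<lambda>x. \<lambda>i\<in>I. X i x)"
proof -
  have "finite (range (\<lambda>x. \<lambda>i\<in>I. X i x))"
    by (rule finite_subset[of _ "PiE I (\<lambda>i. range (X i))"])
      (use assms in \<open>auto intro!: finite_PiE simp: simple_function_iff\<close>)
  moreover have "(\<lambda>x. \<lambda>i\<in>I. X i x) -` {b} \<in> sets M" for b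
  proof (cases "b \<in> extensional I")
    case True
    then have "(\<lambda>x. \<lambda>i\<in>I. X i x) -` {b} = {x \<in> space M. \<forall>i\<in>I. x \<in> X i -` {b i}}"
      by (auto simp: fun_eq_iff restrict_def extensional_def)
    also have "\<dots> \<in> sets M"
      using assms by (intro sets.sets_Collect_finite_All) (simp_all add: simple_function_iff vimage_def)
    finally show ?thesis .
  next
    case False
    then have "(\<lambda>x. \<lambda>i\<in>I. X i x) -` {b} = {}" by auto
    then show ?thesis by simp
  qed
  ultimately show ?thesis by (simp add: simple_function_iff)
qed

lemma factor_through:
  assumes "\<And>x y. Y x = Y y \<Longrightarrow> X x = X y"
  shows "X = (\<lambda>b. X (SOME x. Y x = b)) \<circ> Y"
proof
  fix x
  have "Y (SOME y. Y y = Y x) = Y x" by (rule someI) (rule refl)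
  then show "X x = ((\<lambda>b. X (SOME x. Y x = b)) \<circ> Y) x" using assms by (metis comp_apply)
qed

lemma simple_function_factors:
  assumes "simple_function M Y" "\<And>x y. Y x = Y y \<Longrightarrow> X x = X y"
  shows "simple_function M X"
  using factor_through[of Y X, OF assms(2)] simple_function_compose[OF assms(1)] by metis

text \<open>If \<open>Y\<close> determines \<open>X\<close>, then \<open>X\<close> is a function of
  \<open>Y\<close>, and data processing cannot increase entropy.\<close>

lemma level_entropy_mono:
  assumes "simple_function M Y" "\<And>x y. Y x = Y y \<Longrightarrow> X x = X y"
  shows "level_entropy X \<le> level_entropy Y"
  using entropy_data_processing[OF assms(1), of "\<lambda>b. X (SOME x. Y x = b)"]
    level_entropy_eq[OF assms(1)] level_entropy_eq[OF simple_function_factors[OF assms]]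
    factor_through[of Y X, OF assms(2)] by simp

text \<open>Chain rule, together with the fact that conditioning does not increase entropy.\<close>

lemma level_entropy_Pair:
  assumes X: "simple_function M X" and Y: "simple_function M Y"
  shows "level_entropy (\<lambda>x. (X x, Y x)) \<le> level_entropy X + level_entropy Y"
  using entropy_chain_rule[OF X Y] conditional_entropy_less_eq_entropy[OF Y X]
    level_entropy_eq[OF X] level_entropy_eq[OF Y] level_entropy_eq[OF simple_function_Pair[OF X Y]]
  by simp

lemma level_entropy_le_card:
  assumes "simple_function M X" "range X \<subseteq> B" "finite B"
  shows "level_entropy X \<le> ln (real (card B))"
proof -
  have "level_entropy X \<le> ln (real (card (range X)))"
    using entropy_le_card[OF simple_distributedI[OF assms(1) measure_nonneg refl]]
    by (simp add: level_entropy_eq[OF assms(1)] log_def)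
  also have "\<dots> \<le> ln (real (card B))"
    using card_mono[OF assms(3,2)] assms finite_subset[OF assms(2,3)]
    by (subst ln_le_cancel_iff) (auto simp: card_gt_0_iff)
  finally show ?thesis .
qed

lemma level_entropy_nonneg: 
  "0 \<le> level_entropy X"
proof -
  have "measure M p * ln (measure M p) \<le> 0" for p
    using prob_le_1[of p] by (cases "measure M p = 0") (simp_all add: mult_le_0_iff zero_less_measure_iff)
  then show ?thesis unfolding partition_entropy_def by (simp add: sum_nonpos)
qed

lemma level_entropy_tuple:
  assumes "finite I" and "\<And>i. i \<in> I \<Longrightarrow> simple_function M (X i)"
  shows "level_entropy (\<lambda>x. \<lambda>i\<in>I. X i x) \<le> (\<Sum>i\<in>I. level_entropy (X i))"
  using assms
proof (induction I rule: finite_induct)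
  case empty
  show ?case using level_entropy_le_card[of "\<lambda>x. \<lambda>i\<in>{}. X i x" "{\<lambda>i\<in>{}. undefined}"]
    simple_function_tuple[of "{}" X] by (auto simp: restrict_def)
next
  case (insert j I)
  note t = simple_function_tuple[of I X, OF insert.hyps(1) insert.prems]
  have "level_entropy (\<lambda>x. \<lambda>i\<in>insert j I. X i x) \<le> level_entropy (\<lambda>x. (X j x, \<lambda>i\<in>I. X i x))"
    using insert.prems t
    by (intro level_entropy_mono simple_function_Pair) (auto simp: fun_eq_iff restrict_def, metis)
  also have "\<dots> \<le> level_entropy (X j) + level_entropy (\<lambda>x. \<lambda>i\<in>I. X i x)"
    using insert.prems t by (intro level_entropy_Pair) auto
  also have "level_entropy (\<lambda>x. \<lambda>i\<in>I. X i x) \<le> (\<Sum>i\<in>I. level_entropy (X i))"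
    using insert by blast
  finally show ?case by (simp only: sum.insert[OF insert.hyps(1,2)])
qed

lemma level_entropy_uniform:
  assumes X: "simple_function M X" and "0 < c" and unif: "\<And>b. b \<in> range X \<Longrightarrow> measure M (X -` {b}) = 1 / c"
  shows "level_entropy X = ln c"
proof -
  have "level_entropy X = - (\<Sum>b\<in>range X. measure M (X -` {b}) * ln (1 / c))"
    using unif by (simp add: level_entropy_sum)
  also have "\<dots> = - ((\<Sum>b\<in>range X. measure M (X -` {b})) * ln (1 / c))"
    by (simp add: sum_distrib_right)
  also have "(\<Sum>b\<in>range X. measure M (X -` {b})) = 1"
    using simple_distributed_sum_space[OF simple_distributedI[OF X measure_nonneg refl]] by simp
  finally show ?thesis using \<open>0 < c\<close> by (simp add: ln_div)
qed

lemma measure_vimage_invariant: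
  assumes "T \<in> measurable M M" "distr M M T = M" "A \<in> sets M"
  shows "measure M (T -` A) = measure M A"
  using measure_distr[OF assms(1,3)] assms(2) by simp

lemma
  assumes X: "simple_function M X" and T: "T \<in> measurable M M" "distr M M T = M"
  shows simple_function_invariant: "simple_function M (\<lambda>x. X (T x))"
    and level_entropy_invariant: "level_entropy (\<lambda>x. X (T x)) = level_entropy X"
proof -
  have sets: "X -` {b} \<in> sets M" for b using X by (simp add: simple_function_iff)
  have vim: "(\<lambda>x. X (T x)) -` {b} = T -` (X -` {b})" for b by auto
  have "T -` (X -` {b}) \<in> sets M" for b using measurable_sets[OF T(1) sets[of b]] by simp
  moreover have "finite (range (\<lambda>x. X (T x)))"
    by (rule finite_subset[of _ "range X"]) (use X in \<open>auto simp: simple_function_iff\<close>)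
  ultimately show XT: "simple_function M (\<lambda>x. X (T x))"
    by (simp add: simple_function_iff vim)
  let ?f = "\<lambda>b. measure M (X -` {b}) * ln (measure M (X -` {b}))"
  have "(\<Sum>b\<in>range (\<lambda>x. X (T x)). ?f b) = (\<Sum>b\<in>range X. ?f b)"
  proof (rule sum.mono_neutral_left)
    show "finite (range X)" using X by (simp add: simple_function_iff)
    show "range (\<lambda>x. X (T x)) \<subseteq> range X" by auto
    \<comment> \<open>\<open>T\<close> need not be surjective: a value of \<open>X\<close> missed by
      \<open>X (T x)\<close> has an empty preimage, hence by invariance a cell of measure 0, which
      contributes nothing.\<close>
    show "\<forall>b\<in>range X - range (\<lambda>x. X (T x)). ?f b = 0"
    proof
      fix b assume "b \<in> range X - range (\<lambda>x. X (T x))"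
      then have "X (T x) \<noteq> b" for x by blast
      then have "T -` (X -` {b}) = {}" by auto
      then show "?f b = 0" using measure_vimage_invariant[OF T sets[of b]] by simp
    qed
  qed
  then show "level_entropy (\<lambda>x. X (T x)) = level_entropy X"
    unfolding level_entropy_sum vim by (simp add: measure_vimage_invariant[OF T sets])
qed

section \<open>Dynamical entropy\<close>

lemma invariant_funpow:
  assumes "T \<in> measurable M M" "distr M M T = M"
  shows "(T ^^ n) \<in> measurable M M \<and> distr M M (T ^^ n) = M"
proof (induction n)
  case (Suc n)
  then have n: "(T ^^ n) \<in> measurable M M" and dn: "distr M M (T ^^ n) = M" by auto
  have "distr M M (T \<circ> T ^^ n) = distr (distr M M (T ^^ n)) M T"
    using distr_distr[OF assms(1) n] by simp
  also have "\<dots> = M" unfolding dn by (rule assms(2))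
  finally show ?case using measurable_comp[OF n assms(1)] by (simp add: comp_def)
qed (simp add: distr_id2)

definition orbit_entropy :: "('x \<Rightarrow> 'b) \<Rightarrow> ('x \<Rightarrow> 'x) \<Rightarrow> nat \<Rightarrow> real" where
  "orbit_entropy X F N = level_entropy (\<lambda>x. \<lambda>i\<in>{..<N}. X ((F ^^ i) x))"

context
  fixes X :: "'x \<Rightarrow> 'b" and F
  assumes X: "simple_function M X" and F: "F \<in> measurable M M" "distr M M F = M"
begin

lemma simple_function_orbit: "simple_function M (\<lambda>x. \<lambda>i\<in>{..<N}. X ((F ^^ i) x))"
  using invariant_funpow[OF F] simple_function_invariant[OF X]
  by (intro simple_function_tuple) auto

text \<open>An orbit segment of length \<open>m + n\<close> is one of length \<open>m\<close>
  followed by one of length \<open>n\<close> started at \<open>(F ^^ m) x\<close>. By invariance the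
  latter has the entropy of an initial segment, so the entropies are subadditive in the
  length.\<close>

lemma dynamical_entropy_lim:
  "(\<lambda>N. orbit_entropy X F N / real N) \<longlonglongrightarrow> dynamical_entropy M (level_sets X) F"
proof -
  have "orbit_entropy X F (m + n) \<le> orbit_entropy X F m + orbit_entropy X F n" for m n
  proof -
    have m: "(F ^^ m) \<in> measurable M M" "distr M M (F ^^ m) = M"
      using invariant_funpow[OF F] by auto
    let ?Y = "\<lambda>N x. \<lambda>i\<in>{..<N}. X ((F ^^ i) x)"
    have Yn: "simple_function M (\<lambda>x. ?Y n ((F ^^ m) x))"
      by (rule simple_function_invariant[OF simple_function_orbit m])
    have "orbit_entropy X F (m + n) \<le> level_entropy (\<lambda>x. (?Y m x, ?Y n ((F ^^ m) x)))"
      unfolding orbit_entropy_def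
    proof (rule level_entropy_mono)
      show "simple_function M (\<lambda>x. (?Y m x, ?Y n ((F ^^ m) x)))"
        by (intro simple_function_Pair simple_function_orbit Yn)
      fix x y assume eq: "(?Y m x, ?Y n ((F ^^ m) x)) = (?Y m y, ?Y n ((F ^^ m) y))"
      then have m: "?Y m x = ?Y m y" and n: "?Y n ((F ^^ m) x) = ?Y n ((F ^^ m) y)" by blast+
      have "X ((F ^^ i) x) = X ((F ^^ i) y)" if "i < m + n" for i
      proof (cases "i < m")
        case True
        then show ?thesis using fun_cong[OF m, of i] by simp
      next
        case False
        then have i: "i = (i - m) + m" and "i - m < n" using that by auto
        then have "X ((F ^^ (i - m)) ((F ^^ m) x)) = X ((F ^^ (i - m)) ((F ^^ m) y))"
          using fun_cong[OF n, of "i - m"] by simp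
        then show ?thesis by (subst (1 2) i) (simp only: funpow_add comp_apply)
      qed
      then show "?Y (m + n) x = ?Y (m + n) y" by (auto simp: restrict_def)
    qed
    also have "\<dots> \<le> level_entropy (?Y m) + level_entropy (\<lambda>x. ?Y n ((F ^^ m) x))"
      by (intro level_entropy_Pair simple_function_orbit Yn)
    also have "level_entropy (\<lambda>x. ?Y n ((F ^^ m) x)) = level_entropy (?Y n)"
      by (rule level_entropy_invariant[OF simple_function_orbit m])
    finally show ?thesis unfolding orbit_entropy_def .
  qed
  then have "convergent (\<lambda>N. orbit_entropy X F N / real N)"
    by (rule fekete_convergent) (simp add: orbit_entropy_def level_entropy_nonneg)
  moreover have "dynamical_entropy M (level_sets X) F = lim (\<lambda>N. orbit_entropy X F N / real N)"
    unfolding dynamical_entropy_def orbit_entropy_def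
    by (simp only: join_level_sets[of _ "\<lambda>i. F ^^ i" "\<lambda>_. X"])
  ultimately show ?thesis by (simp add: convergent_LIMSEQ_iff)
qed

text \<open>The constant \<open>C\<close> stands for information about the starting point; it is
  paid once and disappears after division by \<open>N\<close>.\<close>

lemma dynamical_entropy_le:
  assumes "\<And>N. orbit_entropy X F N \<le> C + real N * D"
  shows "dynamical_entropy M (level_sets X) F \<le> D"
proof (rule LIMSEQ_le[OF dynamical_entropy_lim])
  show "(\<lambda>N. C / real N + D) \<longlonglongrightarrow> D"
    using tendsto_add[OF lim_const_over_n[of C] tendsto_const[of D]] by simp
  have "orbit_entropy X F N / real N \<le> C / real N + D" if "N \<ge> 1" for N
    using assms[of N] that by (simp add: field_simps)
  then show "\<exists>N. \<forall>n\<ge>N. orbit_entropy X F n / real n \<le> C / real n + D" by blast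
qed

lemma dynamical_entropy_ge:
  assumes "\<And>N. real N * D \<le> orbit_entropy X F N"
  shows "D \<le> dynamical_entropy M (level_sets X) F"
proof (rule LIMSEQ_le_const[OF dynamical_entropy_lim])
  have "D \<le> orbit_entropy X F N / real N" if "N \<ge> 1" for N
    using assms[of N] that by (simp add: field_simps)
  then show "\<exists>N. \<forall>n\<ge>N. D \<le> orbit_entropy X F n / real n" by blast
qed

end

end

section \<open>The uniform Bernoulli measure\<close>

interpretation bernoulli: full_prob_space uniform_bernoulli
  by (intro full_prob_space.intro full_prob_space_axioms.intro prob_space_uniform_bernoulli
      space_uniform_bernoulli)

lemma sets_uniform_bernoulli_gen:
  "sets uniform_bernoulli = sigma_sets UNIV {{x. x i \<in> A} | i (A :: bit set). True}"
  unfolding uniform_bernoulli_def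
  by (subst sets_PiM_single)
    (simp add: space_uniform_count_measure sets_uniform_count_measure)

lemma simple_function_coordinate: "simple_function uniform_bernoulli (\<lambda>x. x i)"
proof -
  have "(\<lambda>x. x i) -` {b} \<in> sets uniform_bernoulli" for b :: bit
    unfolding sets_uniform_bernoulli_gen vimage_def by (intro sigma_sets.Basic) blast
  moreover have "finite (range (\<lambda>x :: bit config. x i))"
    by (rule finite_subset[of _ UNIV]) auto
  ultimately show ?thesis by (simp add: bernoulli.simple_function_iff)
qed

text \<open>The alphabet is finite, so a function of finitely many coordinates factors through a
  finite-valued measurable tuple.\<close>

lemma simple_function_local:
  assumes "finite W" and "\<And>x y :: bit config. (\<And>u. u \<in> W \<Longrightarrow> x u = y u) \<Longrightarrow> g x = g y"
  shows "simple_function uniform_bernoulli g"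
proof (rule bernoulli.simple_function_factors)
  show "simple_function uniform_bernoulli (\<lambda>x. \<lambda>u\<in>W. x u)"
    by (intro bernoulli.simple_function_tuple assms simple_function_coordinate)
  fix x y :: "bit config" assume "(\<lambda>u\<in>W. x u) = (\<lambda>u\<in>W. y u)"
  then show "g x = g y" by (intro assms(2)) (metis restrict_apply')
qed

lemma measurable_uniform_bernoulli:
  assumes "\<And>z. simple_function uniform_bernoulli (\<lambda>x. T x z)"
  shows "T \<in> measurable uniform_bernoulli uniform_bernoulli"
proof (rule measurable_sigma_sets[OF sets_uniform_bernoulli_gen])
  fix A :: "bit config set" assume "A \<in> {{x. x i \<in> A} | i A. True}"
  then obtain i B where A: "A = {x :: bit config. x i \<in> B}" by blast
  have "T -` A = (\<Union>b\<in>B. (\<lambda>x. T x i) -` {b})" by (auto simp: A)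
  also have "\<dots> \<in> sets uniform_bernoulli"
    using assms[of i] finite_subset[of B UNIV]
    by (intro sets.finite_UN) (auto simp: bernoulli.simple_function_iff)
  finally show "T -` A \<inter> space uniform_bernoulli \<in> sets uniform_bernoulli" by simp
qed auto

section \<open>Cylinder measures and invariant maps\<close>

lemma product_prob_space_letters:
  "product_prob_space (\<lambda>_ :: site. uniform_count_measure (UNIV :: bit set))"
  by (intro product_prob_spaceI prob_space_uniform_count_measure) auto

lemma prod_emb_letters:
  "prod_emb UNIV (\<lambda>_ :: site. uniform_count_measure (UNIV :: bit set)) J (PiE J A) =
    {x. \<forall>j\<in>J. x j \<in> A j}"
  unfolding prod_emb_def by (simp add: space_uniform_count_measure PiE_iff vimage_def)

lemma bernoulli_measure_cylinder:
  assumes "finite J"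
  shows "measure uniform_bernoulli {x. \<forall>j\<in>J. x j = a j} = 1 / 2 ^ card J"
proof -
  interpret P: product_prob_space "\<lambda>_ :: site. uniform_count_measure (UNIV :: bit set)" UNIV
    by (rule product_prob_space_letters)
  have "measure uniform_bernoulli (prod_emb UNIV (\<lambda>_. uniform_count_measure UNIV) J (PiE J (\<lambda>j. {a j}))) =
     (\<Prod>j\<in>J. measure (uniform_count_measure UNIV) {a j})"
    unfolding uniform_bernoulli_def
    by (rule P.measure_PiM_emb) (auto simp: assms sets_uniform_count_measure)
  also have "\<dots> = 1 / 2 ^ card J"
    by (simp add: measure_letter power_divide)
  also have "prod_emb UNIV (\<lambda>_. uniform_count_measure UNIV) J (PiE J (\<lambda>j. {a j})) = {x. \<forall>j\<in>J. x j = a j}"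
    unfolding prod_emb_letters by simp
  finally show ?thesis .
qed

lemma vimage_restrict:
  assumes "b \<in> extensional J"
  shows "(\<lambda>x. \<lambda>j\<in>J. G x j) -` {b} = {x. \<forall>j\<in>J. G x j = b j}"
proof -
  have "(\<lambda>j\<in>J. G x j) = b" if "\<forall>j\<in>J. G x j = b j" for x
    using that assms by (intro extensionalityI[of _ J]) simp_all
  moreover have "G x j = b j" if "(\<lambda>j\<in>J. G x j) = b" "j \<in> J" for x j
    using fun_cong[OF that(1), of j] that(2) by simp
  ultimately show ?thesis by blast
qed

text \<open>The event splits into point cylinders of equal measure. As the result depends on
  \<open>J\<close> and \<open>A\<close> only, the comparison of a map \<open>T\<close> with the
  identity is immediate.\<close>

lemma bernoulli_measure_cylinder_sets:
  fixes T :: "bit config \<Rightarrow> 'j \<Rightarrow> bit"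
  assumes J: "finite J" and T: "\<And>z. simple_function uniform_bernoulli (\<lambda>x. T x z)"
    and cyl: "\<And>a. measure uniform_bernoulli {x. \<forall>j\<in>J. T x j = a j} = 1 / 2 ^ card J"
  shows "measure uniform_bernoulli {x. \<forall>j\<in>J. T x j \<in> A j} =
    real (card (PiE J A)) / 2 ^ card J"
proof -
  let ?Y = "\<lambda>x. \<lambda>j\<in>J. T x j"
  have Y: "simple_function uniform_bernoulli ?Y"
    by (intro bernoulli.simple_function_tuple J T)
  have "finite (A j)" for j by (rule finite_subset[of _ UNIV]) auto
  then have fin: "finite (PiE J A)" by (intro finite_PiE J)
  have cell: "?Y -` {b} = {x. \<forall>j\<in>J. T x j = b j}" if "b \<in> PiE J A" for b
    using that by (intro vimage_restrict) (auto simp: PiE_def)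
  have "{x. \<forall>j\<in>J. T x j \<in> A j} = (\<Union>b\<in>PiE J A. ?Y -` {b})"
    by (auto simp: PiE_iff)
  also have "measure uniform_bernoulli \<dots> = (\<Sum>b\<in>PiE J A. measure uniform_bernoulli (?Y -` {b}))"
    using Y by (intro bernoulli.finite_measure_finite_Union fin)
      (auto simp: bernoulli.simple_function_iff disjoint_family_on_def)
  also have "\<dots> = (\<Sum>b\<in>PiE J A. 1 / 2 ^ card J)"
    using cell cyl by (intro sum.cong) auto
  finally show ?thesis by simp
qed

text \<open>A product measure is determined by finite-dimensional cylinders, and over a finite
  alphabet these reduce to cylinders that fix single letters.\<close>

lemma bernoulli_invariantI:
  assumes T: "\<And>z. simple_function uniform_bernoulli (\<lambda>x. T x z)"
    and cyl: "\<And>J a. finite J \<Longrightarrow>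
      measure uniform_bernoulli {x. \<forall>j\<in>J. T x j = a j} = 1 / 2 ^ card J"
  shows "distr uniform_bernoulli uniform_bernoulli T = uniform_bernoulli"
proof -
  let ?u = "\<lambda>_ :: site. uniform_count_measure (UNIV :: bit set)"
  interpret P: product_prob_space ?u UNIV
    by (rule product_prob_space_letters)
  note Tm = measurable_uniform_bernoulli[of T, OF T]
  have "distr uniform_bernoulli uniform_bernoulli T = PiM UNIV ?u"
  proof (rule P.PiM_eq)
    show "sets (distr uniform_bernoulli uniform_bernoulli T) = sets (PiM UNIV ?u)"
      by (simp add: uniform_bernoulli_def)
    fix J :: "site set" and A :: "site \<Rightarrow> bit set" assume J: "finite J"
    let ?C = "prod_emb UNIV ?u J (PiE J A)"
    have sets: "?C \<in> sets uniform_bernoulli"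
      unfolding uniform_bernoulli_def by (rule sets_PiM_I) (auto simp: J sets_uniform_count_measure)
    have C: "?C = {x. \<forall>j\<in>J. x j \<in> A j}"
      by (rule prod_emb_letters)
    have "T -` ?C = {x. \<forall>j\<in>J. T x j \<in> A j}" by (auto simp: C)
    then have "emeasure (distr uniform_bernoulli uniform_bernoulli T) ?C =
        ennreal (measure uniform_bernoulli {x. \<forall>j\<in>J. T x j \<in> A j})"
      by (simp add: emeasure_distr[OF Tm sets] bernoulli.emeasure_eq_measure)
    also have "\<dots> = ennreal (measure uniform_bernoulli {x. \<forall>j\<in>J. x j \<in> A j})"
      using bernoulli_measure_cylinder_sets[of J T A, OF J T cyl[OF J]]
        bernoulli_measure_cylinder_sets[of J "\<lambda>x. x" A, OF J simple_function_coordinate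
          bernoulli_measure_cylinder[OF J]] by simp
    also have "\<dots> = emeasure (PiM UNIV ?u) ?C"
      using bernoulli.emeasure_eq_measure[of ?C] by (simp add: C uniform_bernoulli_def)
    also have "\<dots> = (\<Prod>j\<in>J. emeasure (?u j) (A j))"
      by (rule P.emeasure_PiM_emb) (auto simp: J sets_uniform_count_measure)
    finally show "emeasure (distr uniform_bernoulli uniform_bernoulli T) ?C =
      (\<Prod>j\<in>J. emeasure (?u j) (A j))" .
  qed
  then show ?thesis by (simp add: uniform_bernoulli_def)
qed

lemma bit_add_eq_iff: "a + b = c \<longleftrightarrow> a = b + c" for a b c :: bit
  by (cases a; cases b; cases c) auto

lemma bernoulli_translation_invariant:
  fixes w :: "bit config"
  shows "(\<lambda>x z. x z + w z) \<in> measurable uniform_bernoulli uniform_bernoulli"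
    and "distr uniform_bernoulli uniform_bernoulli (\<lambda>x z. x z + w z) = uniform_bernoulli"
proof -
  have *: "simple_function uniform_bernoulli (\<lambda>x. x z + w z)" for z
    by (rule simple_function_local[of "{z}"]) auto
  then show "(\<lambda>x z. x z + w z) \<in> measurable uniform_bernoulli uniform_bernoulli"
    by (rule measurable_uniform_bernoulli)
  show "distr uniform_bernoulli uniform_bernoulli (\<lambda>x z. x z + w z) = uniform_bernoulli"
  proof (rule bernoulli_invariantI[OF *])
    fix J :: "site set" and a assume "finite J"
    then have "measure uniform_bernoulli {x. \<forall>j\<in>J. x j = w j + a j} = 1 / 2 ^ card J"
      by (rule bernoulli_measure_cylinder)
    then show "measure uniform_bernoulli {x. \<forall>j\<in>J. x j + w j = a j} = 1 / 2 ^ card J"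
      by (simp only: bit_add_eq_iff)
  qed
qed

text \<open>Translations by configurations permute the fibres of \<open>G\<close> transitively and preserve the
  measure, so all fibres have the same measure.\<close>

lemma additive_uniform:
  fixes G :: "bit config \<Rightarrow> 'j \<Rightarrow> bit"
  assumes J: "finite J"
    and add: "\<And>x y j. j \<in> J \<Longrightarrow> G (\<lambda>z. x z + y z) j = G x j + G y j"
    and simple: "\<And>j. j \<in> J \<Longrightarrow> simple_function uniform_bernoulli (\<lambda>x. G x j)"
    and surj: "\<And>a. \<exists>x. \<forall>j\<in>J. G x j = a j"
  shows "measure uniform_bernoulli {x. \<forall>j\<in>J. G x j = a j} = 1 / 2 ^ card J"
    and "bernoulli.level_entropy (\<lambda>x. \<lambda>j\<in>J. G x j) = real (card J) * ln 2"
proof -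
  let ?Y = "\<lambda>x. \<lambda>j\<in>J. G x j"
  let ?C = "\<lambda>a. {x. \<forall>j\<in>J. G x j = a j}"
  have Y: "simple_function uniform_bernoulli ?Y"
    by (intro bernoulli.simple_function_tuple J simple)
  have cell: "?Y -` {b} = ?C b" if "b \<in> PiE J (\<lambda>_. UNIV)" for b
    using that by (intro vimage_restrict) (auto simp: PiE_def)
  have sets: "?C c \<in> sets uniform_bernoulli" for c
  proof -
    \<comment> \<open>The fibre only sees \<open>c\<close> on \<open>J\<close>; restricting
      \<open>c\<close> makes it extensional, so that \<open>cell\<close> applies.\<close>
    have "?C c = ?C (restrict c J)" by simp
    also have "\<dots> = ?Y -` {restrict c J}" by (intro cell[symmetric]) (simp only: restrict_PiE_iff, simp)
    finally have "?C c = ?Y -` {restrict c J}" .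
    then show ?thesis using Y by (simp only: bernoulli.simple_function_iff)
  qed
  have range: "range ?Y = PiE J (\<lambda>_. UNIV)"
  proof
    show "PiE J (\<lambda>_. UNIV) \<subseteq> range ?Y"
    proof
      fix b :: "'j \<Rightarrow> bit" assume b: "b \<in> PiE J (\<lambda>_. UNIV)"
      obtain x where "x \<in> ?C b" using surj[of b] by blast
      then have "?Y x = b" unfolding cell[OF b, symmetric] by (rule vimage_singleton_eq[THEN iffD1])
      then show "b \<in> range ?Y" by (rule subst[where P = "\<lambda>b. b \<in> range ?Y"]) (rule rangeI)
    qed
  qed auto
  have eq: "measure uniform_bernoulli (?C c) = measure uniform_bernoulli (?C a)" for c
  proof -
    \<comment> \<open>Modulo 2, \<open>c + (a + c) = a\<close>, so adding this \<open>w\<close>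
      carries the fibre over \<open>c\<close> to the fibre over \<open>a\<close>.\<close>
    obtain w where w: "\<And>j. j \<in> J \<Longrightarrow> G w j = a j + c j" using surj[of "\<lambda>j. a j + c j"] by blast
    have "G (\<lambda>z. x z + w z) j = a j \<longleftrightarrow> G x j = c j" if "j \<in> J" for x j
      unfolding add[OF that] w[OF that] by (cases "G x j"; cases "a j"; cases "c j") auto
    then have "(\<lambda>x z. x z + w z) -` ?C a = ?C c" unfolding vimage_def by blast
    then show ?thesis
      using bernoulli.measure_vimage_invariant[OF bernoulli_translation_invariant[of w] sets[of a]]
      by simp
  qed
  have "1 = (\<Sum>b\<in>range ?Y. measure uniform_bernoulli (?Y -` {b}))"
    using bernoulli.simple_distributed_sum_space[OF
        bernoulli.simple_distributedI[OF Y measure_nonneg refl]] by simp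
  also have "\<dots> = (\<Sum>b\<in>PiE J (\<lambda>_. UNIV :: bit set). measure uniform_bernoulli (?C a))"
    unfolding range by (intro sum.cong refl) (subst cell, assumption, rule eq)
  also have "\<dots> = 2 ^ card J * measure uniform_bernoulli (?C a)"
    by (simp add: card_PiE J) (simp add: UNIV_bit)
  finally show a: "measure uniform_bernoulli (?C a) = 1 / 2 ^ card J" by (simp add: field_simps)
  have "measure uniform_bernoulli (?Y -` {b}) = 1 / 2 ^ card J" if "b \<in> range ?Y" for b
    using that unfolding range by (subst cell, assumption) (rule trans[OF eq a])
  then have "bernoulli.level_entropy ?Y = ln (2 ^ card J)"
    using Y by (intro bernoulli.level_entropy_uniform) simp_all
  then show "bernoulli.level_entropy ?Y = real (card J) * ln 2"
    by (simp add: ln_realpow)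
qed

lemma bernoulli_additive_invariant:
  assumes add: "\<And>x y z. T (\<lambda>z. x z + y z) z = T x z + T y z"
    and simple: "\<And>z. simple_function uniform_bernoulli (\<lambda>x. T x z)"
    and surj: "\<And>J a. finite J \<Longrightarrow> \<exists>x. \<forall>j\<in>J. T x j = a j"
  shows "distr uniform_bernoulli uniform_bernoulli T = uniform_bernoulli"
  by (intro bernoulli_invariantI additive_uniform simple add surj)

lemma bernoulli_shift_invariant:
  shows "shift v \<in> measurable uniform_bernoulli uniform_bernoulli"
    and "distr uniform_bernoulli uniform_bernoulli (shift v) = uniform_bernoulli"
proof -
  have *: "simple_function uniform_bernoulli (\<lambda>x. shift v x z)" for z
    by (rule simple_function_local[of "{z + v}"]) (auto simp: shift_def)
  then show "shift v \<in> measurable uniform_bernoulli uniform_bernoulli"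
    by (rule measurable_uniform_bernoulli)
  show "distr uniform_bernoulli uniform_bernoulli (shift v) = uniform_bernoulli"
  proof (rule bernoulli_additive_invariant[OF _ *])
    fix J :: "site set" and a :: "site \<Rightarrow> bit"
    show "\<exists>x. \<forall>j\<in>J. shift v x j = a j"
      by (rule exI[of _ "\<lambda>u. a (u - v)"]) (simp add: shift_def)
  qed (simp add: shift_def)
qed

section \<open>Approximation of measurable sets by events on finite squares\<close>

definition depends_on :: "site set \<Rightarrow> bit config set \<Rightarrow> bool" where
  "depends_on W A \<longleftrightarrow> (\<forall>x y. (\<forall>u\<in>W. x u = y u) \<longrightarrow> (x \<in> A \<longleftrightarrow> y \<in> A))"

lemma square_mono: "k \<le> l \<Longrightarrow> square k \<subseteq> square l"
  by (auto simp: square_def)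

lemma finite_square [simp]: "finite (square k)"
  by (simp add: square_def)

lemma depends_on_mono: "depends_on W A \<Longrightarrow> W \<subseteq> W' \<Longrightarrow> depends_on W' A"
  unfolding depends_on_def by blast

lemma depends_on_sets:
  assumes "depends_on W A" "finite W"
  shows "A \<in> sets uniform_bernoulli"
proof -
  have "simple_function uniform_bernoulli (\<lambda>x. x \<in> A)"
    using assms unfolding depends_on_def by (intro simple_function_local[of W]) auto
  then have "(\<lambda>x. x \<in> A) -` {True} \<in> sets uniform_bernoulli"
    by (simp only: bernoulli.simple_function_iff)
  then show ?thesis by (simp add: vimage_def)
qed

text \<open>Events on a single coordinate are local, and the approximable sets are closed under
  complements and countable unions; induction over the generated sigma-algebra gives the
  rest.\<close>

lemma local_approximation:
  assumes "A \<in> sets uniform_bernoulli" "0 < \<epsilon>"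
  shows "\<exists>k B. depends_on (square k) B \<and> measure uniform_bernoulli ((A - B) \<union> (B - A)) < \<epsilon>"
proof -
  have "A \<in> sigma_sets UNIV {{x. x i \<in> A} | i (A :: bit set). True}"
    using assms(1) by (simp only: sets_uniform_bernoulli_gen)
  then show ?thesis using assms(2)
  proof (induction arbitrary: \<epsilon> rule: sigma_sets.induct)
    case (Basic A)
    then obtain i B where A: "A = {x. x i \<in> B}" by blast
    define k where "k = nat (max \<bar>fst i\<bar> \<bar>snd i\<bar>)"
    have "i \<in> square k" by (cases i) (auto simp: k_def square_def)
    then have "depends_on (square k) A" by (auto simp: depends_on_def A)
    then show ?case using Basic by (intro exI[of _ k] exI[of _ A]) auto
  next
    case Empty
    then show ?case by (intro exI[of _ 0] exI[of _ "{}"]) (auto simp: depends_on_def)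
  next
    case (Compl A)
    then obtain k B where B: "depends_on (square k) B"
      "measure uniform_bernoulli ((A - B) \<union> (B - A)) < \<epsilon>" by blast
    have "((UNIV - A) - (UNIV - B)) \<union> ((UNIV - B) - (UNIV - A)) = (A - B) \<union> (B - A)" by blast
    then show ?case using B
      by (intro exI[of _ k] exI[of _ "UNIV - B"]) (auto simp: depends_on_def)
  next
    case (Union A)
    have A: "A i \<in> sets uniform_bernoulli" for i
      using Union.hyps by (simp add: sets_uniform_bernoulli_gen)
    let ?U = "\<Union>i. A i" and ?V = "\<lambda>n. \<Union>i<n. A i"
    \<comment> \<open>Continuity from below: finitely many of the \<open>A i\<close> exhaust the
      union up to \<epsilon> / 2.\<close>
    have "(\<lambda>n. measure uniform_bernoulli (?V n)) \<longlonglongrightarrow> measure uniform_bernoulli (\<Union>n. ?V n)"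
      using A by (intro bernoulli.finite_Lim_measure_incseq) (auto simp: incseq_def, blast intro: less_le_trans)
    moreover have "(\<Union>n. ?V n) = ?U" by blast
    ultimately have "\<forall>\<^sub>F n in sequentially. measure uniform_bernoulli ?U - \<epsilon> / 2 < measure uniform_bernoulli (?V n)"
      using \<open>0 < \<epsilon>\<close> by (intro order_tendstoD) auto
    then obtain n where n: "measure uniform_bernoulli ?U - \<epsilon> / 2 < measure uniform_bernoulli (?V n)"
      by (auto simp: eventually_sequentially)
    have "measure uniform_bernoulli (?U - ?V n) = measure uniform_bernoulli ?U - measure uniform_bernoulli (?V n)"
      using A by (intro bernoulli.finite_measure_Diff) auto
    then have UV: "measure uniform_bernoulli (?U - ?V n) < \<epsilon> / 2" using n by simp
    \<comment> \<open>The errors of the \<open>n\<close> sets kept then add up to at most \<epsilon>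
      / 2; the summand 1 covers \<open>n = 0\<close>.\<close>
    define \<delta> where "\<delta> = \<epsilon> / (2 * (real n + 1))"
    have "0 < \<delta>" using \<open>0 < \<epsilon>\<close> by (simp add: \<delta>_def)
    then have "\<forall>i. \<exists>k B. depends_on (square k) B \<and> measure uniform_bernoulli ((A i - B) \<union> (B - A i)) < \<delta>"
      using Union.IH by blast
    then obtain k B where B: "\<And>i. depends_on (square (k i)) (B i)"
      "\<And>i. measure uniform_bernoulli ((A i - B i) \<union> (B i - A i)) < \<delta>" by metis
    let ?K = "\<Sum>i<n. k i" and ?B = "\<Union>i<n. B i"
    have Bsets: "B i \<in> sets uniform_bernoulli" for i using B(1) by (rule depends_on_sets) simp
    have "depends_on (square ?K) (B i)" if "i < n" for i
      using B(1) by (rule depends_on_mono) (intro square_mono member_le_sum, use that in auto)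
    then have dep: "depends_on (square ?K) ?B" unfolding depends_on_def by blast
    let ?D = "\<lambda>i. (A i - B i) \<union> (B i - A i)"
    have "measure uniform_bernoulli ((?U - ?B) \<union> (?B - ?U)) \<le>
        measure uniform_bernoulli ((?U - ?V n) \<union> (\<Union>i<n. ?D i))"
      using A Bsets by (intro bernoulli.finite_measure_mono) auto
    also have "\<dots> \<le> measure uniform_bernoulli (?U - ?V n) + measure uniform_bernoulli (\<Union>i<n. ?D i)"
      using A Bsets by (intro measure_Un_le) auto
    also have "measure uniform_bernoulli (\<Union>i<n. ?D i) \<le> (\<Sum>i<n. measure uniform_bernoulli (?D i))"
      using A Bsets by (intro bernoulli.finite_measure_subadditive_finite) auto
    also have "\<dots> \<le> (\<Sum>i<n. \<delta>)" using B(2) by (intro sum_mono less_imp_le)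
    also have "\<dots> \<le> \<epsilon> / 2" using \<open>0 < \<epsilon>\<close> by (simp add: \<delta>_def field_simps)
    finally have "measure uniform_bernoulli ((?U - ?B) \<union> (?B - ?U)) < \<epsilon>" using UV by simp
    with dep show ?case by blast
  qed
qed

section \<open>Approximation of partitions by local events\<close>

text \<open>With \<open>m = prob D\<close>, the term
  \<open>- m * ln m = 2 * m * ln (1 / sqrt m)\<close> is at most \<open>2 * sqrt m\<close>, and the
  term of the complement is at most \<open>m\<close>, hence at most \<open>sqrt m\<close>. Only the
  decay as \<open>m\<close> tends to 0 matters later.\<close>

lemma (in full_prob_space) level_entropy_event_le:
  assumes D: "D \<in> sets M"
  shows "level_entropy (\<lambda>x. x \<in> D) \<le> 3 * sqrt (prob D)"
proof -
  let ?m = "prob D"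
  let ?h = "\<lambda>p. - (prob p * ln (prob p))"
  have h0: "0 \<le> ?h p" for p
    using prob_le_1[of p] by (cases "prob p = 0") (simp_all add: mult_le_0_iff zero_less_measure_iff)
  \<comment> \<open>Only an inclusion of the level sets in \<open>{D, - D}\<close> holds in general,
    since \<open>D\<close> or its complement may be empty.\<close>
  have "(\<lambda>x. x \<in> D) -` {x \<in> D} \<in> {D, - D}" for x by (cases "x \<in> D") auto
  then have "level_sets (\<lambda>x. x \<in> D) \<subseteq> {D, - D}" unfolding level_sets_def by blast
  then have "(\<Sum>p\<in>level_sets (\<lambda>x. x \<in> D). ?h p) \<le> (\<Sum>p\<in>{D, - D}. ?h p)"
    by (intro sum_mono2 h0) auto
  also have "\<dots> = ?h D + ?h (- D)"
    by (subst sum.insert) (use ComplI in auto)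
  also have "?h D \<le> 2 * sqrt ?m"
  proof (cases "?m = 0")
    case False
    then have pos: "0 < ?m" by (simp add: zero_less_measure_iff)
    have "- ln ?m = 2 * ln (1 / sqrt ?m)" using pos by (simp add: ln_div ln_sqrt)
    also have "\<dots> \<le> 2 * (1 / sqrt ?m)" using ln_le_minus_one[of "1 / sqrt ?m"] pos by simp
    finally have "?m * (- ln ?m) \<le> ?m * (2 * (1 / sqrt ?m))" using pos by (intro mult_left_mono) auto
    also have "\<dots> = 2 * sqrt ?m" using pos by (simp add: field_simps)
    finally show ?thesis by simp
  qed simp
  also have "?h (- D) \<le> ?m"
  proof (cases "?m = 1")
    case True
    then show ?thesis using prob_compl[OF D] by (simp add: Compl_eq_Diff_UNIV)
  next
    case False
    then have pos: "0 < 1 - ?m" using prob_le_1[of D] by linarith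
    have "- ln (1 - ?m) = ln (1 / (1 - ?m))" using pos by (simp add: ln_div)
    also have "\<dots> \<le> 1 / (1 - ?m) - 1" using pos by (intro ln_le_minus_one) simp
    finally have "(1 - ?m) * (- ln (1 - ?m)) \<le> (1 - ?m) * (1 / (1 - ?m) - 1)"
      using pos by (intro mult_left_mono) auto
    also have "\<dots> = ?m" using pos by (simp add: field_simps)
    finally show ?thesis using prob_compl[OF D] by (simp add: Compl_eq_Diff_UNIV)
  qed
  finally have "level_entropy (\<lambda>x. x \<in> D) \<le> 2 * sqrt ?m + ?m"
    by (simp add: partition_entropy_def sum_negf)
  moreover have "?m \<le> sqrt ?m"
    by (rule real_le_rsqrt) (simp add: power2_eq_square mult_left_le)
  ultimately show ?thesis by linarith
qed

lemma (in full_prob_space) simple_function_event: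
  assumes "D \<in> sets M"
  shows "simple_function M (\<lambda>x. x \<in> D)"
proof -
  have "(\<lambda>x. x \<in> D) -` {b} = (if b then D else UNIV - D)" for b by auto
  moreover have "UNIV - D \<in> sets M" using sets.compl_sets[OF assms] by simp
  ultimately show ?thesis
    using assms finite_subset[of "range (\<lambda>x. x \<in> D)" UNIV] by (simp add: simple_function_iff)
qed

text \<open>Each cell \<open>p\<close> is the symmetric difference of a local event and a small error event \<open>D p\<close>, so the
  cell containing a configuration is read off a finite square together with the error events.\<close>

lemma partition_local_approximation:
  assumes P: "finite P" "P \<subseteq> sets uniform_bernoulli"
    and X: "\<And>x. X x \<in> P" "\<And>p x. p \<in> P \<Longrightarrow> x \<in> p \<longleftrightarrow> X x = p"
    and "0 < \<epsilon>"
  obtains k D where "\<And>p. p \<in> P \<Longrightarrow> D p \<in> sets uniform_bernoulli"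
    and "(\<Sum>p\<in>P. bernoulli.level_entropy (\<lambda>x. x \<in> D p)) \<le> \<epsilon>"
    and "\<And>x y. \<lbrakk>\<And>u. u \<in> square k \<Longrightarrow> x u = y u; \<And>p. p \<in> P \<Longrightarrow> x \<in> D p \<longleftrightarrow> y \<in> D p\<rbrakk> \<Longrightarrow> X x = X y"
proof -
  have card: "card P > 0" using P X(1) by (auto simp: card_gt_0_iff)
  \<comment> \<open>Chosen so that \<open>3 * sqrt \<delta>\<close> is \<epsilon> divided by the
    number of cells.\<close>
  define \<delta> where "\<delta> = (\<epsilon> / (3 * real (card P)))\<^sup>2"
  have "0 < \<delta>" using \<open>0 < \<epsilon>\<close> card by (simp add: \<delta>_def)
  then have "\<forall>p\<in>P. \<exists>k B. depends_on (square k) B \<and>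
      measure uniform_bernoulli ((p - B) \<union> (B - p)) < \<delta>"
    using P by (intro ballI local_approximation) auto
  then obtain k B where B: "\<And>p. p \<in> P \<Longrightarrow> depends_on (square (k p)) (B p)"
    "\<And>p. p \<in> P \<Longrightarrow> measure uniform_bernoulli ((p - B p) \<union> (B p - p)) < \<delta>" by metis
  define D where "D p = (p - B p) \<union> (B p - p)" for p
  have D: "D p \<in> sets uniform_bernoulli" if "p \<in> P" for p
    using P depends_on_sets[OF B(1)[OF that]] that unfolding D_def by auto
  have "bernoulli.level_entropy (\<lambda>x. x \<in> D p) \<le> \<epsilon> / real (card P)" if "p \<in> P" for p
  proof -
    have "sqrt (measure uniform_bernoulli (D p)) \<le> sqrt \<delta>"
      using B(2)[OF that] by (simp add: D_def)
    then show ?thesis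
      using bernoulli.level_entropy_event_le[OF D[OF that]] card \<open>0 < \<epsilon>\<close>
      by (simp add: \<delta>_def real_sqrt_abs)
  qed
  then have "(\<Sum>p\<in>P. bernoulli.level_entropy (\<lambda>x. x \<in> D p)) \<le> (\<Sum>p\<in>P. \<epsilon> / real (card P))"
    by (rule sum_mono)
  also have "\<dots> = \<epsilon>" using card by simp
  finally have sum: "(\<Sum>p\<in>P. bernoulli.level_entropy (\<lambda>x. x \<in> D p)) \<le> \<epsilon>" .
  have "X x = X y" if eq: "\<And>u. u \<in> square (\<Sum>p\<in>P. k p) \<Longrightarrow> x u = y u"
    and eqD: "\<And>p. p \<in> P \<Longrightarrow> x \<in> D p \<longleftrightarrow> y \<in> D p" for x y
  proof -
    \<comment> \<open>It suffices to put \<open>x\<close> into the cell of \<open>y\<close>: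
      membership in a cell is membership in its local event, flipped on its error event, and
      \<open>x\<close> and \<open>y\<close> agree on both.\<close>
    let ?p = "X y"
    have p: "?p \<in> P" by (rule X)
    have "depends_on (square (\<Sum>p\<in>P. k p)) (B ?p)"
      using B(1)[OF p] by (rule depends_on_mono) (intro square_mono member_le_sum p, use P in auto)
    then have "x \<in> B ?p \<longleftrightarrow> y \<in> B ?p" using eq unfolding depends_on_def by blast
    moreover have "y \<in> ?p" using X(2)[OF p] by simp
    ultimately have "x \<in> ?p" using eqD[OF p] unfolding D_def by blast
    then show ?thesis using X(2)[OF p] by simp
  qed
  with D sum show ?thesis by (rule that)
qed

section \<open>Entropy rate of neighbour sums\<close>

text \<open>Shifts are bijections, so the direct images in \<open>frame_partition\<close> turn into
  the preimages that \<open>join_level_sets\<close> handles.\<close>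

lemma shift_image: "shift v ` p = shift (- v) -` p"
proof -
  have "shift v (shift (- v) x) = x" "shift (- v) (shift v x) = x" for x :: "'a config"
    by (simp_all add: shift_def)
  then show ?thesis by (metis (no_types, lifting) image_iff subsetI subset_antisym vimageI vimageE)
qed

lemma frame_partition_level_sets:
  "frame_partition r n (level_sets X) = level_sets (\<lambda>x. \<lambda>v\<in>frame r n. X (shift (- v) x))"
  unfolding frame_partition_def shift_image by (rule join_level_sets)

text \<open>At the origin \<open>shift (- v) x\<close> reads \<open>x\<close> at \<open>- v\<close>,
  so it is this symmetry that lets the frame partition observe every frame site.\<close>

lemma frame_uminus: "v \<in> frame r n \<Longrightarrow> - v \<in> frame r n"
  by (cases v) (auto simp: frame_def square_def)

lemma finite_frame [simp]: "finite (frame r n)"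
  by (simp add: frame_def)

lemma card_square: "card (square n) = (2 * n + 1)\<^sup>2"
proof -
  have "nat (int n + 1 + int n) = 2 * n + 1" by simp
  then show ?thesis by (simp add: square_def card_cartesian_product power2_eq_square)
qed

text \<open>Linear growth in \<open>n\<close> is what matters: an entropy error \<epsilon> per frame
  site then changes the rate only by a multiple of \<epsilon>. The constant comes from
  \<open>8 * r * n + 4 * r \<le> 12 * r * n\<close>.\<close>

lemma card_frame_le:
  assumes "r \<le> n" "1 \<le> n"
  shows "real (card (frame r n)) \<le> 12 * real r * real n"
proof -
  have "card (frame r n) = card (square n) - card (square (n - r))"
    unfolding frame_def by (intro card_Diff_subset square_mono) auto
  moreover have "card (square (n - r)) \<le> card (square n)"
    by (intro card_mono square_mono) auto
  ultimately have "real (card (frame r n)) = real (card (square n)) - real (card (square (n - r)))"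
    by (simp only: of_nat_diff)
  also have "\<dots> = (2 * real n + 1)\<^sup>2 - (2 * real (n - r) + 1)\<^sup>2"
    by (simp add: card_square add.commute)
  also have "\<dots> = 8 * real r * real n + 4 * real r - 4 * (real r)\<^sup>2"
    using assms by (simp add: of_nat_diff power2_eq_square algebra_simps)
  also have "\<dots> \<le> 12 * real r * real n"
    using mult_left_mono[of 1 "real n" "real r"] assms zero_le_power2[of "real r"] by linarith
  finally show ?thesis .
qed

lemma card_UNIV_bit: "card (UNIV :: bit set) = 2"
  by (simp add: UNIV_bit)

section \<open>Neighbour sums and prescribed orbits\<close>

definition neighbor_sum :: "site set \<Rightarrow> bit config \<Rightarrow> bit config" where
  "neighbor_sum U x = (\<lambda>z. \<Sum>u\<in>U. x (z + u))"

text \<open>The set \<open>I\<close> plays the role of the sites whose whole neighbourhood lies in \<open>E\<close>: a configuration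
  on \<open>E\<close> can be completed to a preimage of \<open>y\<close> unless \<open>y\<close> contradicts it on \<open>I\<close>.\<close>

definition extendable :: "(bit config \<Rightarrow> bit config) \<Rightarrow> site set \<Rightarrow> site set \<Rightarrow> bool" where
  "extendable F E I \<longleftrightarrow>
    (\<forall>x y. (\<forall>z\<in>I. F x z = y z) \<longrightarrow> (\<exists>x'. (\<forall>z\<in>E. x' z = x z) \<and> F x' = y))"

text \<open>The orbit is built backwards in time. \<open>x0\<close> collects the data for time 0,
  induction yields an \<open>x'\<close> with the later data that equals \<open>F x0\<close> on
  \<open>I\<close>, and extendability yields a preimage of \<open>x'\<close> that equals
  \<open>x0\<close> on \<open>E\<close>.\<close>

lemma extendable_prescribed_orbit:
  assumes ext: "extendable F E I" and "I \<subseteq> E"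
  shows "\<exists>x. (\<forall>z\<in>I. x z = w z) \<and> (\<forall>i<N. \<forall>z\<in>E - I. (F ^^ i) x z = d i z)"
proof (induction N arbitrary: d w)
  case 0
  show ?case by auto
next
  case (Suc N)
  define x0 where "x0 z = (if z \<in> I then w z else d 0 z)" for z
  obtain x' where x': "\<forall>z\<in>I. x' z = F x0 z" "\<forall>i<N. \<forall>z\<in>E - I. (F ^^ i) x' z = d (Suc i) z"
    using Suc.IH[of "F x0" "\<lambda>i. d (Suc i)"] by blast
  obtain x where x: "\<forall>z\<in>E. x z = x0 z" "F x = x'"
    using ext x'(1) unfolding extendable_def by metis
  have "(F ^^ i) x z = d i z" if "i < Suc N" "z \<in> E - I" for i z
  proof (cases i)
    case 0
    then show ?thesis using x(1) that by (simp add: x0_def)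
  next
    case (Suc j)
    then show ?thesis using x(2) x'(2) that by (simp add: funpow_Suc_right del: funpow.simps)
  qed
  moreover have "\<forall>z\<in>I. x z = w z" using x(1) \<open>I \<subseteq> E\<close> by (auto simp: x0_def)
  ultimately show ?case by blast
qed

text \<open>New information enters the square of radius \<open>n\<close> only through its sites outside \<open>I n\<close>; the
  slope \<open>c\<close> of their number is the entropy rate divided by \<open>ln 2\<close>.\<close>

locale frame_ca =
  fixes r :: nat and U :: "site set" and E I :: "nat \<Rightarrow> site set" and c b :: real
  assumes finite_U: "finite U"
    and surj: "\<And>J a. finite J \<Longrightarrow> \<exists>x. \<forall>j\<in>J. neighbor_sum U x j = a j"
    and square_E: "square n \<subseteq> E n"
    and I_E: "I n \<subseteq> E n"
    and outside_I: "r \<le> n \<Longrightarrow> square n - I n \<subseteq> frame r n"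
    and card_outside_I: "r \<le> n \<Longrightarrow> real (card (square n - I n)) = c * real n + b"
    and I_square: "\<lbrakk>z \<in> I n \<inter> square n; u \<in> U\<rbrakk> \<Longrightarrow> z + u \<in> square n"
    and ext: "r \<le> n \<Longrightarrow> extendable (neighbor_sum U) (E n) (I n)"
begin

abbreviation F where "F \<equiv> neighbor_sum U"

lemma F_add: "F (\<lambda>z. x z + y z) = (\<lambda>z. F x z + F y z)"
  unfolding neighbor_sum_def sum.distrib ..

lemma F_funpow_add: "(F ^^ i) (\<lambda>z. x z + y z) = (\<lambda>z. (F ^^ i) x z + (F ^^ i) y z)"
  by (induction i) (simp_all only: funpow_0 funpow.simps comp_apply F_add id_apply)

lemma simple_function_F: "simple_function uniform_bernoulli (\<lambda>x. F x z)"
  by (rule simple_function_local[of "(\<lambda>u. z + u) ` U"]) (auto simp: neighbor_sum_def finite_U)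

lemma F_invariant:
  shows "F \<in> measurable uniform_bernoulli uniform_bernoulli"
    and "distr uniform_bernoulli uniform_bernoulli F = uniform_bernoulli"
  using measurable_uniform_bernoulli[of F, OF simple_function_F]
    bernoulli_additive_invariant[of F, OF fun_cong[OF F_add] simple_function_F surj]
  by blast+

lemmas F_funpow_invariant = bernoulli.invariant_funpow[OF F_invariant]

lemma simple_function_F_funpow: "simple_function uniform_bernoulli (\<lambda>x. (F ^^ i) x z)"
  using bernoulli.simple_function_invariant[OF simple_function_coordinate] F_funpow_invariant by blast

text \<open>The values at exterior sites and times below \<open>N\<close> are independent fair bits
  by \<open>additive_uniform\<close>. As exterior sites lie in the frame, observing the letter at
  the origin along the frame shifts reveals them all.\<close>

lemma orbit_entropy_ge:
  fixes N n :: nat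
  assumes n: "r \<le> n"
  shows "real N * ((c * real n + b) * ln 2) \<le>
    bernoulli.orbit_entropy (\<lambda>x. \<lambda>v\<in>frame r n. shift (- v) x 0) F N"
proof -
  let ?S = "square n - I n"
  let ?J = "{..<N} \<times> ?S"
  let ?G = "\<lambda>x (i, z). (F ^^ i) x z"
  have fin: "finite ?J" by simp
  have "\<exists>x. \<forall>j\<in>?J. ?G x j = a j" for a
  proof -
    obtain x where x: "\<forall>i<N. \<forall>z\<in>E n - I n. (F ^^ i) x z = a (i, z)"
      using extendable_prescribed_orbit[OF ext[OF n] I_E, of undefined N "\<lambda>i z. a (i, z)"] by blast
    have "?G x (i, z) = a (i, z)" if "(i, z) \<in> ?J" for i z
      using x square_E[of n] that by auto
    then show ?thesis by (intro exI[of _ x]) (rule ballI, metis surj_pair)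
  qed
  then have "real (card ?J) * ln 2 = bernoulli.level_entropy (\<lambda>x. \<lambda>j\<in>?J. ?G x j)"
    by (intro additive_uniform(2)[symmetric] fin)
      (simp_all only: split_def F_funpow_add simple_function_F_funpow)
  also have "\<dots> \<le> bernoulli.orbit_entropy (\<lambda>x. \<lambda>v\<in>frame r n. shift (- v) x 0) F N"
    unfolding bernoulli.orbit_entropy_def
  proof (rule bernoulli.level_entropy_mono)
    let ?Y = "\<lambda>x. \<lambda>v\<in>frame r n. shift (- v) x 0"
    have "simple_function uniform_bernoulli ?Y"
      using simple_function_coordinate by (intro bernoulli.simple_function_tuple) (simp_all add: shift_def)
    then show "simple_function uniform_bernoulli (\<lambda>x. \<lambda>i\<in>{..<N}. ?Y ((F ^^ i) x))"
      by (rule bernoulli.simple_function_orbit[OF _ F_invariant])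
    fix x y assume eq: "(\<lambda>i\<in>{..<N}. ?Y ((F ^^ i) x)) = (\<lambda>i\<in>{..<N}. ?Y ((F ^^ i) y))"
    have "(F ^^ i) x z = (F ^^ i) y z" if "i < N" "z \<in> ?S" for i z
    proof -
      \<comment> \<open>The entry of the frame tuple that reads site \<open>z\<close> has index
        \<open>- z\<close>.\<close>
      have nz: "- z \<in> frame r n" using outside_I[OF n] that frame_uminus by blast
      have eq_i: "?Y ((F ^^ i) x) = ?Y ((F ^^ i) y)"
        using fun_cong[OF eq, of i] that by simp
      have "shift z ((F ^^ i) x) 0 = shift z ((F ^^ i) y) 0"
        using fun_cong[OF eq_i, of "- z"] nz by (simp only: restrict_apply' minus_minus)
      then show ?thesis by (simp add: shift_def)
    qed
    then show "(\<lambda>j\<in>?J. ?G x j) = (\<lambda>j\<in>?J. ?G y j)" by (intro restrict_ext) auto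
  qed
  finally show ?thesis using card_outside_I[OF n] by (simp add: card_cartesian_product)
qed

text \<open>Induction on time: a site in \<open>I m\<close> is updated from sites of the square
  only, and agreement at all other sites of the square is assumed for every time.\<close>

lemma F_funpow_square:
  assumes init: "\<And>z. z \<in> square m \<Longrightarrow> x z = y z"
    and out: "\<And>i z. i < N \<Longrightarrow> z \<in> square m - I m \<Longrightarrow> (F ^^ i) x z = (F ^^ i) y z"
  shows "i < N \<Longrightarrow> z \<in> square m \<Longrightarrow> (F ^^ i) x z = (F ^^ i) y z"
proof (induction i arbitrary: z)
  case 0
  then show ?case using init by simp
next
  case (Suc i)
  show ?case
  proof (cases "z \<in> I m")
    case True
    then show ?thesis using Suc I_square[of z m] by (auto simp: neighbor_sum_def intro: sum.cong)
  next
    case False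
    then show ?thesis using out[of "Suc i" z] Suc.prems by simp
  qed
qed

text \<open>By \<open>F_funpow_square\<close> the table of values is determined by the initial
  square and the exterior sites, and each recorded bit costs at most \<open>ln 2\<close>.\<close>

lemma square_orbit_entropy_le:
  assumes "r \<le> m"
  shows "bernoulli.level_entropy (\<lambda>x. \<lambda>(i, z)\<in>{..<N} \<times> square m. (F ^^ i) x z) \<le>
    real (card (square m)) * ln 2 + real N * ((c * real m + b) * ln 2)"
proof -
  \<comment> \<open>The two parts may overlap at time 0, so their sizes are only used as an upper
    bound.\<close>
  let ?J = "{0} \<times> square m \<union> {..<N} \<times> (square m - I m)"
  let ?W = "\<lambda>x. \<lambda>(i, z)\<in>?J. (F ^^ i) x z"
  have fin: "finite ?J" by simp
  have W: "simple_function uniform_bernoulli ?W"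
    by (intro bernoulli.simple_function_tuple fin) (simp_all only: split_def simple_function_F_funpow)
  have "bernoulli.level_entropy (\<lambda>x. \<lambda>(i, z)\<in>{..<N} \<times> square m. (F ^^ i) x z) \<le> bernoulli.level_entropy ?W"
  proof (rule bernoulli.level_entropy_mono[OF W])
    fix x y assume eq: "?W x = ?W y"
    have *: "(F ^^ i) x z = (F ^^ i) y z" if "(i, z) \<in> ?J" for i z
      using fun_cong[OF eq, of "(i, z)"] that by (simp only: restrict_apply' case_prod_conv)
    have init: "x z = y z" if "z \<in> square m" for z
      using *[of 0 z] that by simp
    have out: "(F ^^ i) x z = (F ^^ i) y z" if "i < N" "z \<in> square m - I m" for i z
      using *[of i z] that by simp
    have "(F ^^ i) x z = (F ^^ i) y z" if "i < N" "z \<in> square m" for i z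
      by (rule F_funpow_square[OF init out that])
    then show "(\<lambda>(i, z)\<in>{..<N} \<times> square m. (F ^^ i) x z) = (\<lambda>(i, z)\<in>{..<N} \<times> square m. (F ^^ i) y z)"
      by (intro restrict_ext) (clarsimp simp del: funpow.simps)
  qed
  also have "\<dots> \<le> ln (real (card (PiE ?J (\<lambda>_. UNIV :: bit set))))"
  proof (rule bernoulli.level_entropy_le_card[OF W])
    show "range ?W \<subseteq> PiE ?J (\<lambda>_. UNIV)"
      by (rule image_subsetI) (subst restrict_PiE_iff, intro ballI UNIV_I)
    show "finite (PiE ?J (\<lambda>_. UNIV :: bit set))" by (rule finite_PiE[OF fin finite_UNIV_bit])
  qed
  also have "card (PiE ?J (\<lambda>_. UNIV :: bit set)) = 2 ^ card ?J"
    by (subst card_PiE[OF fin]) (simp only: prod_constant card_UNIV_bit)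
  also have "ln (real (2 ^ card ?J)) = real (card ?J) * ln 2"
    by (simp add: ln_realpow)
  also have "\<dots> \<le> real (card (square m) + N * card (square m - I m)) * ln 2"
    using card_Un_le[of "{0} \<times> square m" "{..<N} \<times> (square m - I m)"]
    by (intro mult_right_mono) (simp_all only: card_cartesian_product of_nat_le_iff, simp_all)
  also have "\<dots> = real (card (square m)) * ln 2 + real N * ((c * real m + b) * ln 2)"
    using card_outside_I[OF assms] by (simp add: algebra_simps)
  finally show ?thesis .
qed

text \<open>The cells seen along the frame are read off the square of radius \<open>n + k\<close>
  and the error events. The radius \<open>k\<close> depends on \<open>P\<close> and \<epsilon> but
  not on \<open>n\<close>, so it does not affect the slope in \<open>n\<close>.\<close>

lemma frame_dynamical_entropy_le:
  assumes P: "finite_measurable_partition uniform_bernoulli P" and "0 < \<epsilon>"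
  obtains k where "\<And>n. r \<le> n \<Longrightarrow> dynamical_entropy uniform_bernoulli (frame_partition r n P) F \<le>
    (c * real (n + k) + b) * ln 2 + real (card (frame r n)) * \<epsilon>"
proof -
  have P: "finite P" "partition_on UNIV P" "P \<subseteq> sets uniform_bernoulli"
    using P by (auto simp: finite_measurable_partition_def)
  obtain X where X: "level_sets X = P" "\<And>x. X x \<in> P" "\<And>p x. p \<in> P \<Longrightarrow> x \<in> p \<longleftrightarrow> X x = p"
    using partition_level_sets[OF P(2)] by blast
  obtain k D where D: "\<And>p. p \<in> P \<Longrightarrow> D p \<in> sets uniform_bernoulli"
    and sum: "(\<Sum>p\<in>P. bernoulli.level_entropy (\<lambda>x. x \<in> D p)) \<le> \<epsilon>"
    and det: "\<And>x y. \<lbrakk>\<And>u. u \<in> square k \<Longrightarrow> x u = y u; \<And>p. p \<in> P \<Longrightarrow> x \<in> D p \<longleftrightarrow> y \<in> D p\<rbrakk> \<Longrightarrow> X x = X y"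
    using partition_local_approximation[OF P(1,3) X(2,3) \<open>0 < \<epsilon>\<close>] by metis
  have "X -` {p} \<in> sets uniform_bernoulli" for p
  proof (cases "p \<in> P")
    case True
    then have "X -` {p} = p" using X(3) by auto
    then show ?thesis using True P by auto
  next
    case False
    then have "X -` {p} = {}" using X(2) by auto
    then show ?thesis by simp
  qed
  then have Xs: "simple_function uniform_bernoulli X"
    using finite_subset[of "range X" P] P X(2) by (auto simp: bernoulli.simple_function_iff)
  show ?thesis
  proof (rule that)
    fix n assume n: "r \<le> n"
    let ?m = "n + k"
    let ?Y = "\<lambda>x. \<lambda>v\<in>frame r n. X (shift (- v) x)"
    have Y: "simple_function uniform_bernoulli ?Y"
      by (intro bernoulli.simple_function_tuple bernoulli.simple_function_invariant[OF Xs]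
          bernoulli_shift_invariant) simp
    \<comment> \<open>The quadratic size of the square enters as a constant in \<open>N\<close> and
      vanishes in the dynamical entropy; only the factor of \<open>N\<close> survives.\<close>
    have "bernoulli.orbit_entropy ?Y F N \<le> real (card (square ?m)) * ln 2 +
        real N * ((c * real ?m + b) * ln 2 + real (card (frame r n)) * \<epsilon>)" for N
    proof -
      let ?A = "\<lambda>x. \<lambda>(i, z)\<in>{..<N} \<times> square ?m. (F ^^ i) x z"
      let ?J = "{..<N} \<times> frame r n \<times> P"
      let ?G = "\<lambda>j x. case j of (i, v, p) \<Rightarrow> shift (- v) ((F ^^ i) x) \<in> D p"
      let ?B = "\<lambda>x. \<lambda>j\<in>?J. ?G j x"
      have fin: "finite ?J" using P by simp
      have A: "simple_function uniform_bernoulli ?A"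
        by (intro bernoulli.simple_function_tuple)
          (auto simp: simple_function_F_funpow split: prod.splits)
      have sv: "simple_function uniform_bernoulli (\<lambda>x. shift (- v) x \<in> D p)"
        "bernoulli.level_entropy (\<lambda>x. shift (- v) x \<in> D p) = bernoulli.level_entropy (\<lambda>x. x \<in> D p)"
        if "p \<in> P" for v p
        using bernoulli.simple_function_invariant[OF bernoulli.simple_function_event[OF D[OF that]]
            bernoulli_shift_invariant]
          bernoulli.level_entropy_invariant[OF bernoulli.simple_function_event[OF D[OF that]]
            bernoulli_shift_invariant] by auto
      \<comment> \<open>Shifts and iterates of \<open>F\<close> preserve the measure, so each entry
        of \<open>?B\<close> has the entropy of its event \<open>D p\<close>.\<close>
      have G: "simple_function uniform_bernoulli (?G (i, v, p))"
        "bernoulli.level_entropy (?G (i, v, p)) = bernoulli.level_entropy (\<lambda>x. x \<in> D p)"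
        if "p \<in> P" for i v p
        using bernoulli.simple_function_invariant[OF sv(1)[OF that, of v], of "F ^^ i"]
          bernoulli.level_entropy_invariant[OF sv(1)[OF that, of v], of "F ^^ i"]
          F_funpow_invariant[of i] sv(2)[OF that, of v] by simp_all
      have Gs: "simple_function uniform_bernoulli (?G j)" if "j \<in> ?J" for j
        using G(1) that by (cases j) auto
      have B: "simple_function uniform_bernoulli ?B"
        by (rule bernoulli.simple_function_tuple[OF fin Gs])
      have A_le: "bernoulli.level_entropy ?A \<le>
          real (card (square ?m)) * ln 2 + real N * ((c * real ?m + b) * ln 2)"
        using n by (intro square_orbit_entropy_le) simp
      have "bernoulli.level_entropy ?B \<le> (\<Sum>j\<in>?J. bernoulli.level_entropy (?G j))"
        by (rule bernoulli.level_entropy_tuple[OF fin Gs])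
      also have "\<dots> = (\<Sum>(i, v, p)\<in>?J. bernoulli.level_entropy (\<lambda>x. x \<in> D p))"
        using G(2) by (intro sum.cong) auto
      also have "\<dots> = real N * real (card (frame r n)) * (\<Sum>p\<in>P. bernoulli.level_entropy (\<lambda>x. x \<in> D p))"
        by (simp add: sum.cartesian_product[symmetric] mult.assoc)
      also have "\<dots> \<le> real N * real (card (frame r n)) * \<epsilon>"
        using sum by (intro mult_left_mono) auto
      finally have B_le: "bernoulli.level_entropy ?B \<le> real N * real (card (frame r n)) * \<epsilon>" .
      have "bernoulli.orbit_entropy ?Y F N \<le> bernoulli.level_entropy (\<lambda>x. (?A x, ?B x))"
        unfolding bernoulli.orbit_entropy_def
      proof (rule bernoulli.level_entropy_mono)
        show "simple_function uniform_bernoulli (\<lambda>x. (?A x, ?B x))"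
          using A B by (rule simple_function_Pair)
        fix x y assume "(?A x, ?B x) = (?A y, ?B y)"
        then have eqA: "?A x = ?A y" and eqB: "?B x = ?B y" by blast+
        have "X (shift (- v) ((F ^^ i) x)) = X (shift (- v) ((F ^^ i) y))"
          if "i < N" "v \<in> frame r n" for i v
        proof (rule det)
          fix u assume "u \<in> square k"
          then have "u + - v \<in> square ?m"
            using that(2) by (cases u; cases v) (auto simp: frame_def square_def)
          then show "shift (- v) ((F ^^ i) x) u = shift (- v) ((F ^^ i) y) u"
            using fun_cong[OF eqA, of "(i, u + - v)"] that(1) by (simp add: shift_def)
        next
          fix p assume "p \<in> P"
          then show "shift (- v) ((F ^^ i) x) \<in> D p \<longleftrightarrow> shift (- v) ((F ^^ i) y) \<in> D p"
            using fun_cong[OF eqB, of "(i, v, p)"] that by simp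
        qed
        then show "(\<lambda>i\<in>{..<N}. ?Y ((F ^^ i) x)) = (\<lambda>i\<in>{..<N}. ?Y ((F ^^ i) y))"
          by (intro restrict_ext) auto
      qed
      also have "\<dots> \<le> bernoulli.level_entropy ?A + bernoulli.level_entropy ?B"
        by (rule bernoulli.level_entropy_Pair[OF A B])
      also have "\<dots> \<le> real (card (square ?m)) * ln 2 + real N * ((c * real ?m + b) * ln 2) +
          real N * real (card (frame r n)) * \<epsilon>"
        using A_le B_le by (rule add_mono)
      also have "\<dots> = real (card (square ?m)) * ln 2 +
          real N * ((c * real ?m + b) * ln 2 + real (card (frame r n)) * \<epsilon>)"
        by (simp only: distrib_left add.assoc mult.assoc)
      finally show ?thesis .
    qed
    then show "dynamical_entropy uniform_bernoulli (frame_partition r n P) F \<le>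
        (c * real (n + k) + b) * ln 2 + real (card (frame r n)) * \<epsilon>"
      unfolding X(1)[symmetric] frame_partition_level_sets
      by (rule bernoulli.dynamical_entropy_le[OF Y F_invariant])
  qed
qed

lemma entropy_rate_partition_le:
  assumes P: "finite_measurable_partition uniform_bernoulli P"
  shows "entropy_rate_partition r uniform_bernoulli P F \<le> ereal (c * ln 2)"
proof (rule ereal_le_epsilon2)
  fix e :: real assume "0 < e"
  \<comment> \<open>Makes the total error over the frame at most \<open>e * n\<close> by
    \<open>card_frame_le\<close>; the summand 1 keeps the denominator positive.\<close>
  define \<epsilon> where "\<epsilon> = e / (12 * (real r + 1))"
  have \<epsilon>: "0 < \<epsilon>" using \<open>0 < e\<close> by (simp add: \<epsilon>_def)
  obtain k where k: "\<And>n. r \<le> n \<Longrightarrow> dynamical_entropy uniform_bernoulli (frame_partition r n P) F \<le>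
    (c * real (n + k) + b) * ln 2 + real (card (frame r n)) * \<epsilon>"
    using frame_dynamical_entropy_le[OF P \<epsilon>] by blast
  let ?g = "\<lambda>n. (c * ln 2 + e) + (c * real k + b) * ln 2 / real n"
  have le: "dynamical_entropy uniform_bernoulli (frame_partition r n P) F / real n \<le> ?g n"
    if n: "max r 1 \<le> n" for n
  proof -
    have "real (card (frame r n)) * \<epsilon> \<le> 12 * real r * real n * \<epsilon>"
      using card_frame_le[of r n] n \<epsilon> by (intro mult_right_mono) auto
    also have "\<dots> = (12 * real r * \<epsilon>) * real n" by simp
    also have "\<dots> \<le> e * real n"
      using \<open>0 < e\<close> by (intro mult_right_mono) (simp_all add: \<epsilon>_def field_simps)
    finally have "dynamical_entropy uniform_bernoulli (frame_partition r n P) F \<le>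
        (c * real (n + k) + b) * ln 2 + e * real n" using k[of n] n by simp
    then have "dynamical_entropy uniform_bernoulli (frame_partition r n P) F / real n \<le>
        ((c * real (n + k) + b) * ln 2 + e * real n) / real n"
      by (intro divide_right_mono) auto
    also have "\<dots> = ?g n" using n by (simp add: field_simps)
    finally show ?thesis .
  qed
  have "entropy_rate_partition r uniform_bernoulli P F \<le> limsup (\<lambda>n. ereal (?g n))"
    unfolding entropy_rate_partition_def
    by (intro Limsup_mono eventually_sequentiallyI[of "max r 1"]) (use le in simp)
  also have "\<dots> = ereal (c * ln 2 + e)"
  proof (rule lim_imp_Limsup)
    have "?g \<longlonglongrightarrow> (c * ln 2 + e) + 0" by (intro tendsto_intros lim_const_over_n)
    then show "(\<lambda>n. ereal (?g n)) \<longlonglongrightarrow> ereal (c * ln 2 + e)" by simp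
  qed simp
  finally show "entropy_rate_partition r uniform_bernoulli P F \<le> ereal (c * ln 2) + ereal e" by simp
qed

text \<open>The partition by the letter at the origin already attains the supremum.\<close>

lemma entropy_rate_partition_ge:
  "ereal (c * ln 2) \<le> entropy_rate_partition r uniform_bernoulli (level_sets (\<lambda>x. x 0)) F"
proof -
  let ?g = "\<lambda>n. c * ln 2 + b * ln 2 / real n"
  have "?g n \<le> dynamical_entropy uniform_bernoulli (frame_partition r n (level_sets (\<lambda>x. x 0))) F / real n"
    if n: "max r 1 \<le> n" for n
  proof -
    have Y: "simple_function uniform_bernoulli (\<lambda>x. \<lambda>v\<in>frame r n. shift (- v) x 0)"
      using simple_function_coordinate by (intro bernoulli.simple_function_tuple) (simp_all add: shift_def)
    have "(c * real n + b) * ln 2 \<le>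
        dynamical_entropy uniform_bernoulli (frame_partition r n (level_sets (\<lambda>x. x 0))) F"
      unfolding frame_partition_level_sets
      using n by (intro bernoulli.dynamical_entropy_ge[OF Y F_invariant] orbit_entropy_ge) simp
    then have "(c * real n + b) * ln 2 / real n \<le>
        dynamical_entropy uniform_bernoulli (frame_partition r n (level_sets (\<lambda>x. x 0))) F / real n"
      by (intro divide_right_mono) auto
    moreover have "(c * real n + b) * ln 2 / real n = ?g n" using n by (simp add: field_simps)
    ultimately show ?thesis by simp
  qed
  then have "limsup (\<lambda>n. ereal (?g n)) \<le>
      entropy_rate_partition r uniform_bernoulli (level_sets (\<lambda>x. x 0)) F"
    unfolding entropy_rate_partition_def
    by (intro Limsup_mono eventually_sequentiallyI[of "max r 1"]) simp
  moreover have "limsup (\<lambda>n. ereal (?g n)) = ereal (c * ln 2)"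
  proof (rule lim_imp_Limsup)
    have "?g \<longlonglongrightarrow> c * ln 2 + 0" by (intro tendsto_intros lim_const_over_n)
    then show "(\<lambda>n. ereal (?g n)) \<longlonglongrightarrow> ereal (c * ln 2)" by simp
  qed simp
  ultimately show ?thesis by simp
qed

theorem entropy_rate_eq: "entropy_rate r uniform_bernoulli F = ereal (c * ln 2)"
  unfolding entropy_rate_def
proof (rule antisym)
  show "(SUP P\<in>{P. finite_measurable_partition uniform_bernoulli P}.
      entropy_rate_partition r uniform_bernoulli P F) \<le> ereal (c * ln 2)"
    by (intro SUP_least entropy_rate_partition_le) simp
  let ?P = "level_sets (\<lambda>x :: bit config. x 0)"
  have "finite_measurable_partition uniform_bernoulli ?P"
    unfolding finite_measurable_partition_def
  proof (intro conjI)
    have P: "?P = (\<lambda>b. (\<lambda>x. x 0) -` {b}) ` range (\<lambda>x :: bit config. x 0)"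
      by (auto simp: level_sets_def)
    show "finite ?P" "?P \<subseteq> sets uniform_bernoulli"
      using simple_function_coordinate[of 0] by (auto simp: P bernoulli.simple_function_iff)
    show "partition_on (space uniform_bernoulli) ?P"
      by (auto simp: partition_on_def disjoint_def level_sets_def)
  qed
  then show "ereal (c * ln 2) \<le> (SUP P\<in>{P. finite_measurable_partition uniform_bernoulli P}.
      entropy_rate_partition r uniform_bernoulli P F)"
    by (intro SUP_upper2[where i = ?P] entropy_rate_partition_ge) simp
qed

end

section \<open>The four automata\<close>

lemma neighbor_sum_zero: "neighbor_sum U (\<lambda>_. 0) = (\<lambda>_. 0)"
  by (simp add: neighbor_sum_def)

text \<open>Extend \<open>a\<close> by 0 outside \<open>J\<close>. As \<open>I\<close> misses
  \<open>J\<close>, the zero configuration solves the equation on \<open>I\<close>, and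
  extendability solves it everywhere.\<close>

lemma extendable_surj:
  assumes "extendable (neighbor_sum U) E I" "I \<inter> J = {}"
  shows "\<exists>x. \<forall>j\<in>J. neighbor_sum U x j = a j"
proof -
  define y where "y z = (if z \<in> J then a z else 0)" for z
  have "\<forall>z\<in>I. neighbor_sum U (\<lambda>_. 0) z = y z"
    using assms(2) by (auto simp: neighbor_sum_zero y_def)
  then obtain x where "neighbor_sum U x = y" using assms(1) unfolding extendable_def by blast
  then show ?thesis by (intro exI[of _ x]) (simp add: y_def)
qed

lemma neighbor_sum_uminus:
  "neighbor_sum (uminus ` U) x z = neighbor_sum U (\<lambda>z. x (- z)) (- z)"
  by (simp add: neighbor_sum_def sum.reindex)

lemma extendable_uminus:
  assumes "extendable (neighbor_sum U) E I"
  shows "extendable (neighbor_sum (uminus ` U)) (uminus ` E) (uminus ` I)"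
  unfolding extendable_def
proof (intro allI impI)
  fix x y :: "bit config" assume xy: "\<forall>z\<in>uminus ` I. neighbor_sum (uminus ` U) x z = y z"
  then have "\<forall>z\<in>I. neighbor_sum U (\<lambda>z. x (- z)) z = y (- z)"
    by (simp add: neighbor_sum_uminus)
  then obtain x' where x': "\<forall>z\<in>E. x' z = x (- z)" "neighbor_sum U x' = (\<lambda>z. y (- z))"
    using assms[unfolded extendable_def, rule_format, of "\<lambda>z. x (- z)" "\<lambda>z. y (- z)"] by blast
  show "\<exists>x'. (\<forall>z\<in>uminus ` E. x' z = x z) \<and> neighbor_sum (uminus ` U) x' = y"
    by (rule exI[of _ "\<lambda>z. x' (- z)"]) (use x' in \<open>auto simp: neighbor_sum_uminus\<close>)
qed

lemma uminus_square: "uminus ` square n = square n"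
  by (auto simp: square_def image_iff intro!: bexI[of _ "- _"])

lemma uminus_frame: "uminus ` frame r n = frame r n"
  using frame_uminus by (force simp: image_iff)

lemma frame_ca_uminus:
  assumes "frame_ca r U E I c b"
  shows "frame_ca r (uminus ` U) (\<lambda>n. uminus ` E n) (\<lambda>n. uminus ` I n) c b"
proof -
  interpret frame_ca r U E I c b by (rule assms)
  have diff: "square n - uminus ` I n = uminus ` (square n - I n)" for n
    using uminus_square[of n] by (simp add: image_set_diff inj_uminus)
  show ?thesis
  proof
    fix J :: "site set" and a :: "site \<Rightarrow> bit" assume "finite J"
    then obtain x where "\<forall>j\<in>uminus ` J. neighbor_sum U x j = a (- j)"
      using surj[of "uminus ` J" "\<lambda>j. a (- j)"] by auto
    then show "\<exists>x. \<forall>j\<in>J. neighbor_sum (uminus ` U) x j = a j"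
      by (intro exI[of _ "\<lambda>z. x (- z)"]) (simp add: neighbor_sum_uminus)
  next
    fix n
    show "square n \<subseteq> uminus ` E n" using image_mono[OF square_E[of n], of uminus] by (simp add: uminus_square)
    show "uminus ` I n \<subseteq> uminus ` E n" by (intro image_mono I_E)
    show "r \<le> n \<Longrightarrow> square n - uminus ` I n \<subseteq> frame r n"
      using image_mono[OF outside_I[of n], of uminus] by (simp add: diff uminus_frame)
    show "r \<le> n \<Longrightarrow> real (card (square n - uminus ` I n)) = c * real n + b"
      using card_outside_I[of n] by (simp add: diff card_image)
    show "r \<le> n \<Longrightarrow> extendable (neighbor_sum (uminus ` U)) (uminus ` E n) (uminus ` I n)"
      by (intro extendable_uminus ext)
    fix z u assume z: "z \<in> uminus ` I n \<inter> square n" and u: "u \<in> uminus ` U"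
    have "- z \<in> I n \<inter> square n" using z uminus_square[of n] by force
    then have "- z + - u \<in> square n" using u by (intro I_square) auto
    then show "z + u \<in> square n" using uminus_square[of n] by (metis image_eqI minus_add_distrib minus_minus)
  qed (simp add: finite_U)
qed

lemma finite_fst_lower_bound:
  assumes "finite (J :: site set)"
  obtains m where "\<And>a b. (a, b) \<in> J \<Longrightarrow> m < a"
proof
  fix a b assume "(a, b) \<in> J"
  then have "Min (fst ` J) \<le> a" using assms by (intro Min_le) (auto intro: rev_image_eqI)
  then show "Min (fst ` J) - 1 < a" by simp
qed

lemma bit_add_cancel: "a + (b + a) = b" "b + a + a = b" for a b :: bit
  by (cases a; cases b; simp)+

text \<open>The equation \<open>F x = y\<close> at \<open>(a, b)\<close> is solved for the value at \<open>(a + s, b)\<close> if \<open>n - s < a\<close>, and for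
  the value at \<open>(a, b + s)\<close> otherwise; the values on \<open>n - s < a \<le> n < b\<close> remain free.\<close>

function extend_12 :: "int \<Rightarrow> int \<Rightarrow> bit config \<Rightarrow> bit config \<Rightarrow> int \<Rightarrow> int \<Rightarrow> bit" where
  "extend_12 s n x y a b =
    (if s \<le> 0 \<or> a \<le> n \<and> b \<le> n then x (a, b)
     else if n < a then y (a - s, b) + extend_12 s n x y (a - s) (b + s)
     else if n - s < a then 0
     else y (a, b - s) + extend_12 s n x y (a + s) (b - s))"
  by auto
termination
  \<comment> \<open>The call with \<open>n < a\<close> lowers the first measure. In the last clause
    \<open>a + s \<le> n\<close>, so the first measure stays 0, and \<open>n < b\<close> lets the
    second one drop.\<close>
  by (relation "measures [\<lambda>(s, n, x, y, a, b). nat (a - n), \<lambda>(s, n, x, y, a, b). nat (b - n)]") auto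

declare extend_12.simps [simp del]

text \<open>Outside the smaller quadrant each equation is the recursion clause for one of its two
  unknowns. Inside it, both terms lie in the larger quadrant, where the given configuration is
  kept.\<close>

lemma extendable_12:
  assumes "1 \<le> r"
  shows "extendable (neighbor_sum {(int r, 0), (0, int r)}) {(a, b). a \<le> n \<and> b \<le> n}
    {(a, b). a \<le> n - int r \<and> b \<le> n - int r}"
  unfolding extendable_def
proof (intro allI impI)
  fix x y :: "bit config"
  have F: "neighbor_sum {(int r, 0), (0, int r)} x (a, b) = x (a + int r, b) + x (a, b + int r)" for x a b
    using assms unfolding neighbor_sum_def by (subst sum.insert) auto
  assume xy: "\<forall>z\<in>{(a, b). a \<le> n - int r \<and> b \<le> n - int r}.
    neighbor_sum {(int r, 0), (0, int r)} x z = y z"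
  let ?x = "\<lambda>(a, b). extend_12 (int r) n x y a b"
  have "neighbor_sum {(int r, 0), (0, int r)} ?x (a, b) = y (a, b)" for a b
  proof -
    consider "n - int r < a" | "a \<le> n - int r" "n - int r < b" | "a \<le> n - int r" "b \<le> n - int r"
      by linarith
    then show ?thesis
    proof cases
      case 1
      have "extend_12 (int r) n x y (a + int r) b = y (a, b) + extend_12 (int r) n x y a (b + int r)"
        using 1 assms by (subst extend_12.simps) simp
      then show ?thesis by (simp only: F prod.case bit_add_cancel)
    next
      case 2
      have "extend_12 (int r) n x y a (b + int r) = y (a, b) + extend_12 (int r) n x y (a + int r) b"
        using 2 assms by (subst extend_12.simps) simp
      then show ?thesis by (simp only: F prod.case bit_add_cancel)
    next
      case 3
      have "extend_12 (int r) n x y (a + int r) b = x (a + int r, b)"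
        using 3 by (subst extend_12.simps) simp
      moreover have "extend_12 (int r) n x y a (b + int r) = x (a, b + int r)"
        using 3 by (subst extend_12.simps) simp
      moreover have "neighbor_sum {(int r, 0), (0, int r)} x (a, b) = y (a, b)"
        using xy 3 by blast
      ultimately show ?thesis by (simp only: F prod.case)
    qed
  qed
  then have "neighbor_sum {(int r, 0), (0, int r)} ?x = y" by (intro ext) (simp only: split_paired_all)
  moreover have "\<forall>z\<in>{(a, b). a \<le> n \<and> b \<le> n}. ?x z = x z"
    by (auto simp: extend_12.simps)
  ultimately show "\<exists>x'. (\<forall>z\<in>{(a, b). a \<le> n \<and> b \<le> n}. x' z = x z) \<and>
      neighbor_sum {(int r, 0), (0, int r)} x' = y" by blast
qed

text \<open>The bounds \<open>s \<le> t + 1\<close> and \<open>u \<le> v + 1\<close> admit empty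
  intervals, for which the counting formula still gives 0.\<close>

lemma real_card_square_diff:
  assumes "square n \<inter> I = {s..t} \<times> {u..v}" "s \<le> t + 1" "u \<le> v + 1"
  shows "real (card (square n - I)) = (2 * real n + 1)\<^sup>2 - of_int (t + 1 - s) * of_int (v + 1 - u)"
proof -
  have "card (square n - I) = card (square n) - card (square n \<inter> I)"
    by (simp add: card_Diff_subset_Int)
  moreover have "card (square n \<inter> I) \<le> card (square n)" by (intro card_mono) auto
  ultimately have "real (card (square n - I)) = real (card (square n)) - real (card (square n \<inter> I))"
    by (simp only: of_nat_diff)
  also have "real (card (square n \<inter> I)) = of_int (t + 1 - s) * of_int (v + 1 - u)"
    using assms by (simp add: assms(1) card_cartesian_product algebra_simps)
  finally show ?thesis by (simp add: card_square add.commute)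
qed

text \<open>The exterior sites form two overlapping bands of width \<open>r\<close> along adjacent
  sides: \<open>(2 * n + 1)\<^sup>2 - (2 * n + 1 - r)\<^sup>2 = 4 * r * n + 2 * r -
  r\<^sup>2\<close>.\<close>

lemma frame_ca_12:
  assumes r: "1 \<le> r"
  shows "frame_ca r {(int r, 0), (0, int r)} (\<lambda>n. {(a, b). a \<le> int n \<and> b \<le> int n})
    (\<lambda>n. {(a, b). a \<le> int n - int r \<and> b \<le> int n - int r}) (4 * real r) (2 * real r - (real r)\<^sup>2)"
proof
  fix J :: "site set" and a :: "site \<Rightarrow> bit" assume "finite J"
  then obtain m where "\<And>a b. (a, b) \<in> J \<Longrightarrow> m < a" by (rule finite_fst_lower_bound) blast
  then show "\<exists>x. \<forall>j\<in>J. neighbor_sum {(int r, 0), (0, int r)} x j = a j"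
    \<comment> \<open>With this corner the set \<open>I\<close> lies in \<open>a \<le> m\<close>, to
      the left of all of \<open>J\<close>.\<close>
    by (intro extendable_surj[OF extendable_12[OF r, of "m + int r"]]) force
next
  fix n assume n: "r \<le> n"
  have "square n \<inter> {(a, b). a \<le> int n - int r \<and> b \<le> int n - int r} =
      {- int n..int n - int r} \<times> {- int n..int n - int r}"
    by (auto simp: square_def)
  from real_card_square_diff[OF this] show "real (card (square n -
      {(a, b). a \<le> int n - int r \<and> b \<le> int n - int r})) = 4 * real r * real n + (2 * real r - (real r)\<^sup>2)"
    using n by (simp add: power2_eq_square algebra_simps)
  show "extendable (neighbor_sum {(int r, 0), (0, int r)}) {(a, b). a \<le> int n \<and> b \<le> int n}
      {(a, b). a \<le> int n - int r \<and> b \<le> int n - int r}"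
    by (rule extendable_12[OF r])
qed (auto simp: square_def frame_def)

text \<open>The bound \<open>2 * h - 1 \<le> t - s\<close> keeps a step of length \<open>2 * h\<close> from jumping over the strip
  \<open>s \<le> a \<le> t\<close>, so that no value is determined from both sides.\<close>

function extend_13 :: "int \<Rightarrow> int \<Rightarrow> int \<Rightarrow> bit config \<Rightarrow> bit config \<Rightarrow> int \<Rightarrow> int \<Rightarrow> bit" where
  "extend_13 h s t x y a b =
    (if h \<le> 0 \<or> t - s < 2 * h - 1 \<or> s \<le> a \<and> a \<le> t then x (a, b)
     else if t < a then y (a - h, b) + extend_13 h s t x y (a - 2 * h) b
     else y (a + h, b) + extend_13 h s t x y (a + 2 * h) b)"
  by auto
termination
  by (relation "measures [\<lambda>(h, s, t, x, y, a, b). nat (a - t) + nat (s - a)]") auto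

declare extend_13.simps [simp del]

text \<open>The equation in column \<open>a\<close> links columns \<open>a + r\<close> and
  \<open>a - r\<close>. It is solved for the former beyond the right edge and for the latter beyond
  the left edge; \<open>st\<close> makes these two cases exclusive.\<close>

lemma extendable_13:
  assumes r: "1 \<le> r" and st: "2 * int r - 1 \<le> t - s"
  shows "extendable (neighbor_sum {(int r, 0), (- int r, 0)}) {(a, b). s \<le> a \<and> a \<le> t}
    {(a, b). s + int r \<le> a \<and> a \<le> t - int r}"
  unfolding extendable_def
proof (intro allI impI)
  fix x y :: "bit config"
  have F: "neighbor_sum {(int r, 0), (- int r, 0)} x (a, b) = x (a + int r, b) + x (a - int r, b)" for x a b
    using r unfolding neighbor_sum_def by (subst sum.insert) auto
  assume xy: "\<forall>z\<in>{(a, b). s + int r \<le> a \<and> a \<le> t - int r}.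
    neighbor_sum {(int r, 0), (- int r, 0)} x z = y z"
  let ?e = "extend_13 (int r) s t x y"
  let ?x = "\<lambda>(a, b). ?e a b"
  have "neighbor_sum {(int r, 0), (- int r, 0)} ?x (a, b) = y (a, b)" for a b
  proof -
    consider "t - int r < a" | "a < s + int r" | "s + int r \<le> a" "a \<le> t - int r"
      by linarith
    then show ?thesis
    proof cases
      case 1
      have "?e (a + int r) b = y (a, b) + ?e (a - int r) b"
        using 1 r st by (subst extend_13.simps) (simp add: algebra_simps)
      then show ?thesis by (simp only: F prod.case bit_add_cancel)
    next
      case 2
      have "?e (a - int r) b = y (a, b) + ?e (a + int r) b"
        using 2 r st by (subst extend_13.simps) (simp add: algebra_simps)
      then show ?thesis by (simp only: F prod.case bit_add_cancel)
    next
      case 3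
      have "?e (a + int r) b = x (a + int r, b)" "?e (a - int r) b = x (a - int r, b)"
        using 3 by (subst extend_13.simps, simp)+
      moreover have "neighbor_sum {(int r, 0), (- int r, 0)} x (a, b) = y (a, b)"
        using xy 3 by blast
      ultimately show ?thesis by (simp only: F prod.case)
    qed
  qed
  then have "neighbor_sum {(int r, 0), (- int r, 0)} ?x = y" by (intro ext) (simp only: split_paired_all)
  moreover have "\<forall>z\<in>{(a, b). s \<le> a \<and> a \<le> t}. ?x z = x z"
    by (auto simp: extend_13.simps)
  ultimately show "\<exists>x'. (\<forall>z\<in>{(a, b). s \<le> a \<and> a \<le> t}. x' z = x z) \<and>
      neighbor_sum {(int r, 0), (- int r, 0)} x' = y" by blast
qed

text \<open>The exterior sites form a left and a right band of width \<open>r\<close> and height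
  \<open>2 * n + 1\<close>.\<close>

lemma frame_ca_13:
  assumes r: "1 \<le> r"
  shows "frame_ca r {(int r, 0), (- int r, 0)} (\<lambda>n. {(a, b). - int n \<le> a \<and> a \<le> int n})
    (\<lambda>n. {(a, b). - int n + int r \<le> a \<and> a \<le> int n - int r}) (4 * real r) (2 * real r)"
proof
  fix J :: "site set" and a :: "site \<Rightarrow> bit" assume "finite J"
  show "\<exists>x. \<forall>j\<in>J. neighbor_sum {(int r, 0), (- int r, 0)} x j = a j"
    \<comment> \<open>The narrowest admissible strip, of \<open>2 * r\<close> columns, makes
      \<open>I\<close> empty, so it misses every \<open>J\<close>.\<close>
    using r by (intro extendable_surj[OF extendable_13[of r "int r - 1" "- int r"]]) auto
next
  fix n assume n: "r \<le> n"
  have "square n \<inter> {(a, b). - int n + int r \<le> a \<and> a \<le> int n - int r} =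
      {- int n + int r..int n - int r} \<times> {- int n..int n}"
    by (auto simp: square_def)
  from real_card_square_diff[OF this] show "real (card (square n -
      {(a, b). - int n + int r \<le> a \<and> a \<le> int n - int r})) = 4 * real r * real n + 2 * real r"
    using n by (simp add: power2_eq_square algebra_simps)
  show "extendable (neighbor_sum {(int r, 0), (- int r, 0)}) {(a, b). - int n \<le> a \<and> a \<le> int n}
      {(a, b). - int n + int r \<le> a \<and> a \<le> int n - int r}"
    using n by (intro extendable_13[OF r]) simp
qed (auto simp: square_def frame_def)

text \<open>Beyond the half-plane the preimage is simply \<open>y\<close> shifted back.\<close>

lemma extendable_1:
  "extendable (neighbor_sum {(int r, 0)}) {(a, b). a \<le> n} {(a, b). a \<le> n - int r}"
  unfolding extendable_def
proof (intro allI impI)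
  fix x y :: "bit config"
  assume xy: "\<forall>z\<in>{(a, b). a \<le> n - int r}. neighbor_sum {(int r, 0)} x z = y z"
  let ?x = "\<lambda>(a, b). if a \<le> n then x (a, b) else y (a - int r, b)"
  have "neighbor_sum {(int r, 0)} ?x (a, b) = y (a, b)" for a b
 
  proof (cases "a \<le> n - int r")
    case True
    then show ?thesis using bspec[OF xy, of "(a, b)"] by (simp add: neighbor_sum_def)
  next
    case False
    then show ?thesis by (simp add: neighbor_sum_def)
  qed
  then have "neighbor_sum {(int r, 0)} ?x = y" by (intro ext) (simp only: split_paired_all)
  then show "\<exists>x'. (\<forall>z\<in>{(a, b). a \<le> n}. x' z = x z) \<and> neighbor_sum {(int r, 0)} x' = y"
    by (intro exI[of _ ?x]) auto
qed

text \<open>Only the right band of width \<open>r\<close> and height \<open>2 * n + 1\<close> is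
  exterior, half of the count for \<open>frame_ca_13\<close>.\<close>

lemma frame_ca_1:
  "frame_ca r {(int r, 0)} (\<lambda>n. {(a, b). a \<le> int n}) (\<lambda>n. {(a, b). a \<le> int n - int r})
    (2 * real r) (real r)"
proof
  fix J :: "site set" and a :: "site \<Rightarrow> bit" assume "finite J"
  then obtain m where "\<And>a b. (a, b) \<in> J \<Longrightarrow> m < a" by (rule finite_fst_lower_bound) blast
  then show "\<exists>x. \<forall>j\<in>J. neighbor_sum {(int r, 0)} x j = a j"
    by (intro extendable_surj[OF extendable_1[of r "m + int r"]]) force
next
  fix n assume n: "r \<le> n"
  have "square n \<inter> {(a, b). a \<le> int n - int r} = {- int n..int n - int r} \<times> {- int n..int n}"
    by (auto simp: square_def)
  from real_card_square_diff[OF this] show "real (card (square n - {(a, b). a \<le> int n - int r})) =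
      2 * real r * real n + real r"
    using n by (simp add: power2_eq_square algebra_simps)
qed (auto simp: square_def frame_def intro: extendable_1)

lemma cellular_automaton_neighbor_sum:
  assumes "1 \<le> r"
  shows "cellular_automaton r (rule_12 r) = neighbor_sum {(int r, 0), (0, int r)}"
    and "cellular_automaton r (rule_34 r) = neighbor_sum (uminus ` {(int r, 0), (0, int r)})"
    and "cellular_automaton r (rule_13 r) = neighbor_sum {(int r, 0), (- int r, 0)}"
    and "cellular_automaton r (rule_1 r) = neighbor_sum {(int r, 0)}"
proof -
  have mem: "(int r, 0) \<in> square r" "(0, int r) \<in> square r" "(- int r, 0) \<in> square r" "(0, - int r) \<in> square r"
    by (auto simp: square_def)
  have sum1: "sum g {p} = g p" for g :: "site \<Rightarrow> bit" and p by simp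
  have sum2: "sum g {p, q} = g p + g q" if "p \<noteq> q" for g :: "site \<Rightarrow> bit" and p q
    using that by (subst sum.insert) auto
  \<comment> \<open>\<open>neighbor_sum\<close> runs over a set, so the two offsets must differ for
    both terms to be counted; this is where \<open>r\<close> is positive.\<close>
  have ne: "(int r, 0) \<noteq> (0, int r)" "(- int r, 0) \<noteq> (0, - int r)" "(int r, 0) \<noteq> (- int r, 0)"
    using assms by auto
  have neg: "uminus ` {(int r, 0), (0, int r)} = {(- int r, 0), (0, - int r)}" by auto
  note defs = cellular_automaton_def neighbor_sum_def mem[THEN restrict_apply'] ne[THEN sum2]
  show "cellular_automaton r (rule_12 r) = neighbor_sum {(int r, 0), (0, int r)}"
    by (intro ext) (simp only: defs rule_12_def)
  show "cellular_automaton r (rule_34 r) = neighbor_sum (uminus ` {(int r, 0), (0, int r)})"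
    unfolding neg by (intro ext) (simp only: defs rule_34_def)
  show "cellular_automaton r (rule_13 r) = neighbor_sum {(int r, 0), (- int r, 0)}"
    by (intro ext) (simp only: defs rule_13_def)
  show "cellular_automaton r (rule_1 r) = neighbor_sum {(int r, 0)}"
    by (intro ext) (simp only: defs rule_1_def sum1)
qed

theorem proposition11:
  fixes r :: nat
  assumes "r \<ge> 1"
  shows
    "entropy_rate r uniform_bernoulli (cellular_automaton r (rule_12 r)) = ereal (4 * real r * ln 2) \<and>
     entropy_rate r uniform_bernoulli (cellular_automaton r (rule_34 r)) = ereal (4 * real r * ln 2) \<and>
     entropy_rate r uniform_bernoulli (cellular_automaton r (rule_13 r)) = ereal (4 * real r * ln 2) \<and>
     entropy_rate r uniform_bernoulli (cellular_automaton r (rule_1 r)) = ereal (2 * real r * ln 2)"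
  unfolding cellular_automaton_neighbor_sum[OF assms]
  using frame_ca.entropy_rate_eq[OF frame_ca_12[OF assms]]
    frame_ca.entropy_rate_eq[OF frame_ca_uminus[OF frame_ca_12[OF assms]]]
    frame_ca.entropy_rate_eq[OF frame_ca_13[OF assms]]
    frame_ca.entropy_rate_eq[OF frame_ca_1]
  by blast

end
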